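(* Let $A\in x^{-m}\mathrm{Diff}^m_b(M;E)$ be $c$-elliptic. Suppose that $\operatorname{ind}A_{\mathcal D_{\min}}\le0$ and $\operatorname{ind}A_{\mathcal D_{\max}}\ge0$, and that $\dim\mathfrak G>0$. Then for every $\lambda\in\mathbb C$ there is $\mathcal D\in\mathfrak G$ such that $\lambda\in\operatorname{spec}A_{\mathcal D}$.
   Context: $M$ is a compact smooth manifold with nonempty boundary $Y$ and interior $\mathring M$; $E\to M$ is a Hermitian vector bundle; $\mathfrak m$ is a smooth positive $b$-density; $x$ is a boundary defining function, positive in $\mathring M$, with $\mathfrak m=\frac{dx}{x}\otimes\mathfrak m_Y$ in a collar of $Y$ ($\mathfrak m_Y$ a smooth positive density on $Y$). $\mathrm{Diff}^m_b(M;E)$ is the space of differential operators $P$ of order $m$ which near $Y$ have the form $\sum_{k+|\alpha|\le m}a_{k\alpha}(x,y)D_y^\alpha(xD_x)^k$, $a_{k\alpha}$ smooth up to $x=0$. $A=x^{-m}P$ is $c$-elliptic if its principal symbol is invertible over $\mathring M$ (off the zero section) and near $Y$ the matrix $\sum_{k+|\alpha|=m}a_{k\alpha}(x,y)\eta^\alpha\xi^k$ is invertible for all real $(\xi,\eta)\ne0$, including at $x=0$. $A$ acts in $x^{-m/2}L^2_b(M;E)=L^2(M,x^m\mathfrak m;E)$. $\mathcal D_{\min}$ is the domain of the closure of $A$ on $C_0^\infty(\mathring M;E)$; $\mathcal D_{\max}=\{u\in x^{-m/2}L^2_b:Au\in x^{-m/2}L^2_b\}$, a Hilbert space with $(u,v)_A=(Au,Av)+(u,v)$.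 For each subspace $\mathcal D_{\min}\subset\mathcal D\subset\mathcal D_{\max}$, $A_{\mathcal D}$ is $A$ with domain $\mathcal D$. Known: $\mathcal D_{\min}$ has finite codimension in $\mathcal D_{\max}$, every $A_{\mathcal D}$ is closed and Fredholm, and $\operatorname{ind}A_{\mathcal D}=\operatorname{ind}A_{\mathcal D_{\min}}+\dim\mathcal D/\mathcal D_{\min}$. $\mathfrak G$ is the set of such $\mathcal D$ with $\dim\mathcal D/\mathcal D_{\min}=-\operatorname{ind}A_{\mathcal D_{\min}}=:d''$ (equivalently $\operatorname{ind}A_{\mathcal D}=0$). With $\mathcal E_{\max}$ the orthogonal complement of $\mathcal D_{\min}$ in $\mathcal D_{\max}$, the bijection $\mathcal D\mapsto\mathcal D\cap\mathcal E_{\max}$ onto the Grassmannian $\mathrm{Gr}_{d''}(\mathcal E_{\max})$ of $d''$-dimensional subspaces gives $\mathfrak G$ the structure of a complex manifold. With $d'=\operatorname{ind}A_{\mathcal D_{\max}}$, $d'+d''=\dim\mathcal E_{\max}$, so $\dim\mathfrak G=d'd''$. *)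

theory Defs
  imports "HOL-Analysis.Analysis" "HOL-Library.Function_Algebras"
begin

section \<open>Smooth functions\<close>

primrec Ck_on :: "nat \<Rightarrow> ('a::real_normed_vector \<Rightarrow> 'b::real_normed_vector) \<Rightarrow> 'a set \<Rightarrow> bool" where
  "Ck_on 0 f S \<longleftrightarrow> continuous_on S f"
| "Ck_on (Suc k) f S \<longleftrightarrow>
     f differentiable_on S \<and> (\<forall>v. Ck_on k (\<lambda>x. frechet_derivative f (at x) v) S)"

text \<open>\<open>Ck_on\<close> is only used on open sets. On an arbitrary set (here: relatively open subsets of a
  half space) a function is smooth if it extends smoothly to a neighbourhood of each point, so
  smoothness on a half space means smoothness up to the boundary.\<close>

definition smooth_on :: "'a::real_normed_vector set \<Rightarrow> ('a \<Rightarrow> 'b::real_normed_vector) \<Rightarrow> bool" where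
  "smooth_on S f \<longleftrightarrow>
     (\<forall>p\<in>S. \<exists>V g. open V \<and> p \<in> V \<and> (\<forall>k. Ck_on k g V) \<and> (\<forall>q\<in>V \<inter> S. f q = g q))"

section \<open>The geometric data\<close>

text \<open>The manifold \<open>M\<close> is the whole type \<open>'p\<close>; its dimension is \<open>CARD('n)\<close> and charts take values in
  the half space of vectors whose coordinate number \<open>nidx\<close> is nonnegative.

  The bundle \<open>E\<close> has rank \<open>CARD('r)\<close>. Every fibre is identified with \<open>\<complex>\<^sup>r\<close> as a bare vector space, by
  an isomorphism that need not depend continuously on the base point; this is no restriction
  on \<open>E\<close>. The smooth structure of \<open>E\<close> is carried by the local trivialisations \<open>(V, \<tau>)\<close> in \<open>trivs\<close>,
  where \<open>\<tau> p\<close> is an isomorphism from the fibre over \<open>p\<close> to \<open>\<complex>\<^sup>r\<close>: only the transition matrices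
  \<open>\<tau>' p (\<tau> p)\<^sup>-\<^sup>1\<close> are required to be smooth in \<open>p\<close>, and \<open>\<tau>\<close> itself may be discontinuous.
  In particular \<open>E\<close> need not be trivial. Sections of \<open>E\<close> are thus functions \<open>'p \<Rightarrow> complex^'r\<close>,
  which are smooth (measurable) if \<open>\<tau> p *v s p\<close> is so in every trivialisation.\<close>

record ('p, 'n::finite, 'r::finite) cone_data =
  atlas :: "('p set \<times> ('p \<Rightarrow> real^'n)) set"
  nidx :: 'n
  trivs :: "('p set \<times> ('p \<Rightarrow> complex^'r^'r)) set"
  herm :: "'p \<Rightarrow> complex^'r \<Rightarrow> complex^'r \<Rightarrow> complex"
  dens :: "'p measure"
  bdf :: "'p \<Rightarrow> real"

type_synonym ('p, 'r) sec = "'p \<Rightarrow> complex^'r"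

definition halfspace :: "'n::finite \<Rightarrow> (real^'n) set" where
  "halfspace i = {v. 0 \<le> v $ i}"

definition set_coord :: "'n::finite \<Rightarrow> real \<Rightarrow> real^'n \<Rightarrow> real^'n" where
  "set_coord i t v = (\<chi> j. if j = i then t else v $ j)"

definition is_chart :: "'n::finite \<Rightarrow> 'p::topological_space set \<times> ('p \<Rightarrow> real^'n) \<Rightarrow> bool" where
  "is_chart i = (\<lambda>(U, \<phi>). open U \<and> openin (top_of_set (halfspace i)) (\<phi> ` U) \<and>
     homeomorphism U (\<phi> ` U) \<phi> (inv_into U \<phi>))"

definition smooth_compat ::
  "'p set \<times> ('p \<Rightarrow> real^'n::finite) \<Rightarrow> 'p set \<times> ('p \<Rightarrow> real^'n) \<Rightarrow> bool" where
  "smooth_compat = (\<lambda>(U, \<phi>) (U', \<phi>').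
     smooth_on (\<phi> ` (U \<inter> U')) (\<phi>' \<circ> inv_into U \<phi>) \<and>
     smooth_on (\<phi>' ` (U \<inter> U')) (\<phi> \<circ> inv_into U' \<phi>'))"

definition smooth_atlas :: "('p::topological_space, 'n::finite, 'r::finite) cone_data \<Rightarrow> bool" where
  "smooth_atlas X \<longleftrightarrow> (\<Union>(fst ` atlas X) = UNIV) \<and> (\<forall>c\<in>atlas X. is_chart (nidx X) c) \<and>
     (\<forall>c\<in>atlas X. \<forall>c'\<in>atlas X. smooth_compat c c')"

definition charts ::
  "('p::topological_space, 'n::finite, 'r::finite) cone_data \<Rightarrow> ('p set \<times> ('p \<Rightarrow> real^'n)) set" where
  "charts X = {c. is_chart (nidx X) c \<and> (\<forall>c'\<in>atlas X. smooth_compat c c')}"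

definition bdry :: "('p, 'n::finite, 'r::finite) cone_data \<Rightarrow> 'p set" where
  "bdry X = {p. \<exists>(U, \<phi>)\<in>atlas X. p \<in> U \<and> \<phi> p $ nidx X = 0}"

abbreviation interior_part :: "('p, 'n::finite, 'r::finite) cone_data \<Rightarrow> 'p set" where
  "interior_part X \<equiv> - bdry X"

definition msmooth_on ::
  "('p, 'n::finite, 'r::finite) cone_data \<Rightarrow> 'p set \<Rightarrow> ('p \<Rightarrow> 'a::real_normed_vector) \<Rightarrow> bool" where
  "msmooth_on X V f \<longleftrightarrow> (\<forall>(U, \<phi>)\<in>atlas X. smooth_on (\<phi> ` (U \<inter> V)) (f \<circ> inv_into U \<phi>))"

definition vector_bundle :: "('p::topological_space, 'n::finite, 'r::finite) cone_data \<Rightarrow> bool" where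
  "vector_bundle X \<longleftrightarrow> (\<Union>(fst ` trivs X) = UNIV) \<and>
     (\<forall>(V, \<tau>)\<in>trivs X. open V \<and> (\<forall>p\<in>V. invertible (\<tau> p))) \<and>
     (\<forall>(V, \<tau>)\<in>trivs X. \<forall>(V', \<tau>')\<in>trivs X.
        msmooth_on X (V \<inter> V') (\<lambda>p. \<tau>' p ** matrix_inv (\<tau> p)))"

definition hermitian_metric :: "('p, 'n::finite, 'r::finite) cone_data \<Rightarrow> bool" where
  "hermitian_metric X \<longleftrightarrow>
     (\<forall>p a b c z. herm X p (a + b) c = herm X p a c + herm X p b c \<and>
        herm X p (z *s a) b = z * herm X p a b \<and> herm X p b a = cnj (herm X p a b) \<and>
        (a \<noteq> 0 \<longrightarrow> 0 < Re (herm X p a a))) \<and>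
     (\<forall>(V, \<tau>)\<in>trivs X. \<forall>a b.
        msmooth_on X V (\<lambda>p. herm X p (matrix_inv (\<tau> p) *v a) (matrix_inv (\<tau> p) *v b)))"

definition boundary_defining :: "('p, 'n::finite, 'r::finite) cone_data \<Rightarrow> bool" where
  "boundary_defining X \<longleftrightarrow> msmooth_on X UNIV (bdf X) \<and>
     (\<forall>p. 0 \<le> bdf X p) \<and> (\<forall>p. bdf X p = 0 \<longleftrightarrow> p \<in> bdry X) \<and>
     (\<forall>(U, \<phi>)\<in>atlas X. \<forall>p\<in>U \<inter> bdry X. \<exists>L. L \<noteq> (\<lambda>_. 0) \<and>
        ((bdf X \<circ> inv_into U \<phi>) has_derivative L) (at (\<phi> p) within \<phi> ` U))"

text \<open>A smooth positive \<open>b\<close>-density is \<open>1/x\<close> times a smooth positive density (both smooth up to the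
  boundary); it is regarded as a Borel measure for which the boundary is a null set.
  \<open>density_in_chart X (U, \<phi>) \<rho>\<close> says that it is \<open>\<rho>(v) dv / x\<close> in the chart.\<close>

definition density_in_chart ::
  "('p::topological_space, 'n::finite, 'r::finite) cone_data \<Rightarrow> 'p set \<times> ('p \<Rightarrow> real^'n) \<Rightarrow>
     (real^'n \<Rightarrow> real) \<Rightarrow> bool" where
  "density_in_chart X = (\<lambda>(U, \<phi>) \<rho>. smooth_on (\<phi> ` U) \<rho> \<and> (\<forall>v\<in>\<phi> ` U. 0 < \<rho> v) \<and>
     (\<forall>B\<in>sets borel. B \<subseteq> U \<inter> interior_part X \<longrightarrow>
        emeasure (dens X) B = (\<integral>\<^sup>+v\<in>\<phi> ` B. ennreal (\<rho> v / bdf X (inv_into U \<phi> v)) \<partial>lborel)))"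

definition b_density :: "('p::topological_space, 'n::finite, 'r::finite) cone_data \<Rightarrow> bool" where
  "b_density X \<longleftrightarrow> sets (dens X) = sets borel \<and> emeasure (dens X) (bdry X) = 0 \<and>
     (\<forall>c\<in>atlas X. \<exists>\<rho>. density_in_chart X c \<rho>)"

text \<open>The collar is the set \<open>{x < \<epsilon>}\<close>, identified with \<open>[0,\<epsilon>) \<times> Y\<close> by the map \<open>(x, r)\<close>. It is covered
  by smooth charts with domain \<open>[0,\<epsilon>) \<times> (U \<inter> Y)\<close> of product form \<open>(x, y)\<close>, where the coordinates \<open>y\<close>
  do not depend on \<open>x\<close>, in which the density is \<open>\<rho>(0,y) dx/x dy\<close>; here \<open>\<rho>(0,y) dy\<close> is the local
  expression of the density of \<open>Y\<close>.\<close>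

definition product_collar :: "('p::topological_space, 'n::finite, 'r::finite) cone_data \<Rightarrow> bool" where
  "product_collar X \<longleftrightarrow> (\<exists>\<epsilon>>0. \<exists>r.
     (\<forall>p. bdf X p < \<epsilon> \<longrightarrow> r p \<in> bdry X) \<and> (\<forall>q\<in>bdry X. r q = q) \<and>
     (\<forall>q\<in>bdry X. \<exists>(U, \<phi>)\<in>charts X. q \<in> U \<and>
        U = {p. bdf X p < \<epsilon> \<and> r p \<in> U} \<and>
        \<phi> ` U = {v. 0 \<le> v $ nidx X \<and> v $ nidx X < \<epsilon> \<and>
                    set_coord (nidx X) 0 v \<in> \<phi> ` (U \<inter> bdry X)} \<and>
        (\<forall>p\<in>U. \<phi> p $ nidx X = bdf X p \<and> \<phi> (r p) = set_coord (nidx X) 0 (\<phi> p)) \<and>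
        (\<exists>\<rho>. density_in_chart X (U, \<phi>) \<rho> \<and>
             (\<forall>v\<in>\<phi> ` U. \<rho> v = \<rho> (set_coord (nidx X) 0 v)))))"

definition cone_geometry :: "('p::t2_space, 'n::finite, 'r::finite) cone_data \<Rightarrow> bool" where
  "cone_geometry X \<longleftrightarrow> compact (UNIV :: 'p set) \<and> smooth_atlas X \<and> bdry X \<noteq> {} \<and>
     vector_bundle X \<and> hermitian_metric X \<and> boundary_defining X \<and> b_density X \<and> product_collar X"

section \<open>Cone differential operators\<close>

text \<open>The space \<open>C\<^sub>0\<^sup>\<infinity>\<close> of sections of \<open>E\<close> over the interior of \<open>M\<close>.\<close>

definition test_sections :: "('p::topological_space, 'n::finite, 'r::finite) cone_data \<Rightarrow> ('p, 'r) sec set" where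
  "test_sections X = {s. (\<forall>(V, \<tau>)\<in>trivs X. msmooth_on X V (\<lambda>p. \<tau> p *v s p)) \<and>
     (\<exists>K. compact K \<and> K \<subseteq> interior_part X \<and> (\<forall>p. p \<notin> K \<longrightarrow> s p = 0))}"

text \<open>\<open>D\<^sub>j = -i \<partial>\<^sub>j\<close>. The derivatives are only ever evaluated at interior points of the half space, on
  functions that are smooth near these points, so the order in which the partial derivatives of a
  multiindex are taken is immaterial.\<close>

definition Dpart :: "'n::finite \<Rightarrow> (real^'n \<Rightarrow> complex^'r::finite) \<Rightarrow> real^'n \<Rightarrow> complex^'r" where
  "Dpart j f = (\<lambda>v. (- \<i>) *s frechet_derivative f (at v) (axis j 1))"

definition coord_list :: "'n::finite list" where
  "coord_list = (SOME l. distinct l \<and> set l = UNIV)"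

definition Dmulti :: "('n::finite \<Rightarrow> nat) \<Rightarrow> (real^'n \<Rightarrow> complex^'r::finite) \<Rightarrow> real^'n \<Rightarrow> complex^'r" where
  "Dmulti \<alpha> f = foldr (\<lambda>j g. (Dpart j ^^ \<alpha> j) g) coord_list f"

text \<open>\<open>D\<^sub>y\<^sup>\<alpha> (x D\<^sub>x)\<^sup>k\<close> with \<open>x\<close> the coordinate number \<open>i\<close>; the multiindex \<open>\<beta>\<close> comprises both
  \<open>k = \<beta> i\<close> and \<open>\<alpha>\<close>, the remaining entries.\<close>

definition Dmulti_b :: "'n::finite \<Rightarrow> ('n \<Rightarrow> nat) \<Rightarrow> (real^'n \<Rightarrow> complex^'r::finite) \<Rightarrow> real^'n \<Rightarrow> complex^'r" where
  "Dmulti_b i \<beta> f = Dmulti (\<beta>(i := 0)) (((\<lambda>g v. v $ i *\<^sub>R Dpart i g v) ^^ \<beta> i) f)"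

text \<open>In the chart \<open>(U, \<phi>)\<close> and the trivialisation \<open>(V, \<tau>)\<close> the operator \<open>Q\<close> is given by
  \<open>\<Sum> a\<^sub>\<alpha> \<D>\<^sup>\<alpha>\<close> (sum over \<open>|\<alpha>| \<le> m\<close>), with coefficients smooth on all of \<open>\<phi>(U \<inter> V)\<close>, including
  its points with \<open>x = 0\<close>.\<close>

definition local_expr ::
  "('p::topological_space, 'n::finite, 'r::finite) cone_data \<Rightarrow> nat \<Rightarrow>
   (('n \<Rightarrow> nat) \<Rightarrow> (real^'n \<Rightarrow> complex^'r) \<Rightarrow> real^'n \<Rightarrow> complex^'r) \<Rightarrow>
   (('p, 'r) sec \<Rightarrow> ('p, 'r) sec) \<Rightarrow>
   'p set \<times> ('p \<Rightarrow> real^'n) \<Rightarrow> 'p set \<times> ('p \<Rightarrow> complex^'r^'r) \<Rightarrow>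
   (('n \<Rightarrow> nat) \<Rightarrow> real^'n \<Rightarrow> complex^'r^'r) \<Rightarrow> bool" where
  "local_expr X m \<D> Q = (\<lambda>(U, \<phi>) (V, \<tau>) a.
     (\<forall>\<alpha>. sum \<alpha> UNIV \<le> m \<longrightarrow> smooth_on (\<phi> ` (U \<inter> V)) (a \<alpha>)) \<and>
     (\<forall>s\<in>test_sections X. \<forall>p\<in>U \<inter> V \<inter> interior_part X.
        \<tau> p *v Q s p =
        (\<Sum>\<alpha> | sum \<alpha> UNIV \<le> m.
           a \<alpha> (\<phi> p) *v \<D> \<alpha> (\<lambda>v. \<tau> (inv_into U \<phi> v) *v s (inv_into U \<phi> v)) (\<phi> p))))"

definition interior_charts ::
  "('p::topological_space, 'n::finite, 'r::finite) cone_data \<Rightarrow> ('p set \<times> ('p \<Rightarrow> real^'n)) set" where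
  "interior_charts X = {c\<in>charts X. fst c \<subseteq> interior_part X}"

text \<open>Charts of the form \<open>(x, y)\<close> with \<open>x\<close> the given boundary defining function.\<close>

definition adapted_charts ::
  "('p::topological_space, 'n::finite, 'r::finite) cone_data \<Rightarrow> ('p set \<times> ('p \<Rightarrow> real^'n)) set" where
  "adapted_charts X = {c\<in>charts X. \<forall>p\<in>fst c. snd c p $ nidx X = bdf X p}"

definition Diff_b ::
  "('p::topological_space, 'n::finite, 'r::finite) cone_data \<Rightarrow> nat \<Rightarrow> (('p, 'r) sec \<Rightarrow> ('p, 'r) sec) set" where
  "Diff_b X m = {P. (\<forall>s\<in>test_sections X. P s \<in> test_sections X) \<and>
     (\<forall>s\<in>test_sections X. \<forall>t\<in>test_sections X. P (s + t) = P s + P t) \<and>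
     (\<forall>c. \<forall>s\<in>test_sections X. P (\<lambda>p. c *s s p) = (\<lambda>p. c *s P s p)) \<and>
     (\<forall>c\<in>interior_charts X. \<forall>t\<in>trivs X. \<exists>a. local_expr X m Dmulti P c t a) \<and>
     (\<forall>c\<in>adapted_charts X. \<forall>t\<in>trivs X. \<exists>a. local_expr X m (Dmulti_b (nidx X)) P c t a)}"

definition cone_Diff ::
  "('p::topological_space, 'n::finite, 'r::finite) cone_data \<Rightarrow> nat \<Rightarrow> (('p, 'r) sec \<Rightarrow> ('p, 'r) sec) set" where
  "cone_Diff X m = {A. \<exists>P\<in>Diff_b X m. \<forall>s\<in>test_sections X.
     A s = (\<lambda>p. complex_of_real (inverse (bdf X p ^ m)) *s P s p)}"

definition symbol ::
  "nat \<Rightarrow> (('n::finite \<Rightarrow> nat) \<Rightarrow> real^'n \<Rightarrow> complex^'r^'r) \<Rightarrow> real^'n \<Rightarrow> real^'n \<Rightarrow> complex^'r^'r::finite" where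
  "symbol m a v \<xi> = (\<Sum>\<alpha> | sum \<alpha> UNIV = m. (\<Prod>j\<in>UNIV. (\<xi> $ j) ^ \<alpha> j) *\<^sub>R a \<alpha> v)"

text \<open>The second condition concerns \<open>P = x\<^sup>m A\<close>; the coefficients \<open>a\<close> are uniquely determined by the
  operator, the chart and the trivialisation.\<close>

definition c_elliptic ::
  "('p::topological_space, 'n::finite, 'r::finite) cone_data \<Rightarrow> nat \<Rightarrow> (('p, 'r) sec \<Rightarrow> ('p, 'r) sec) \<Rightarrow> bool" where
  "c_elliptic X m A \<longleftrightarrow>
     (\<forall>(U, \<phi>)\<in>interior_charts X. \<forall>(V, \<tau>)\<in>trivs X. \<forall>a.
        local_expr X m Dmulti A (U, \<phi>) (V, \<tau>) a \<longrightarrow>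
        (\<forall>v\<in>\<phi> ` (U \<inter> V). \<forall>\<xi>. \<xi> \<noteq> 0 \<longrightarrow> invertible (symbol m a v \<xi>))) \<and>
     (\<forall>(U, \<phi>)\<in>adapted_charts X. \<forall>(V, \<tau>)\<in>trivs X. \<forall>a.
        local_expr X m (Dmulti_b (nidx X)) (\<lambda>s p. complex_of_real (bdf X p ^ m) *s A s p)
          (U, \<phi>) (V, \<tau>) a \<longrightarrow>
        (\<forall>v\<in>\<phi> ` (U \<inter> V). \<forall>\<xi>. \<xi> \<noteq> 0 \<longrightarrow> invertible (symbol m a v \<xi>)))"

section \<open>The Hilbert space \<open>x\<^sup>-\<^sup>m\<^sup>/\<^sup>2 L\<^sup>2\<^sub>b = L\<^sup>2(M, x\<^sup>m \<mm>; E)\<close>\<close>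

definition wmeas :: "('p, 'n::finite, 'r::finite) cone_data \<Rightarrow> nat \<Rightarrow> 'p measure" where
  "wmeas X m = density (dens X) (\<lambda>p. ennreal (bdf X p ^ m))"

definition ip :: "('p, 'n::finite, 'r::finite) cone_data \<Rightarrow> nat \<Rightarrow> ('p, 'r) sec \<Rightarrow> ('p, 'r) sec \<Rightarrow> complex" where
  "ip X m u v = (LINT p|wmeas X m. herm X p (u p) (v p))"

definition L2norm :: "('p, 'n::finite, 'r::finite) cone_data \<Rightarrow> nat \<Rightarrow> ('p, 'r) sec \<Rightarrow> real" where
  "L2norm X m u = sqrt (Re (ip X m u u))"

text \<open>Sections that agree almost everywhere are not identified. Instead, all subspaces considered
  below contain the space \<open>Null\<close> of sections vanishing almost everywhere, and dimensions are those
  of quotients (by \<open>Null\<close>, or by a space containing it).\<close>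

definition L2 :: "('p::topological_space, 'n::finite, 'r::finite) cone_data \<Rightarrow> nat \<Rightarrow> ('p, 'r) sec set" where
  "L2 X m = {u. (\<forall>(V, \<tau>)\<in>trivs X. (\<lambda>p. \<tau> p *v u p) \<in> borel_measurable (restrict_space borel V)) \<and>
     integrable (wmeas X m) (\<lambda>p. herm X p (u p) (u p))}"

definition Null :: "('p::topological_space, 'n::finite, 'r::finite) cone_data \<Rightarrow> nat \<Rightarrow> ('p, 'r) sec set" where
  "Null X m = {u\<in>L2 X m. AE p in wmeas X m. u p = 0}"

definition scale_sec :: "complex \<Rightarrow> ('p, 'r::finite) sec \<Rightarrow> ('p, 'r) sec" where
  "scale_sec c u = (\<lambda>p. c *s u p)"

text \<open>\<open>dim V/W = n\<close> for subspaces \<open>W \<subseteq> V\<close>: some set of \<open>n\<close> vectors of \<open>V\<close> represents a basis of \<open>V/W\<close>.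
  The number \<open>qdim\<close> is \<open>0\<close> by convention if \<open>V/W\<close> is infinite-dimensional.\<close>

definition has_qdim :: "(complex \<Rightarrow> 'a \<Rightarrow> 'a) \<Rightarrow> 'a::ab_group_add set \<Rightarrow> 'a set \<Rightarrow> nat \<Rightarrow> bool" where
  "has_qdim sc V W n \<longleftrightarrow> (\<exists>B. finite B \<and> card B = n \<and> B \<subseteq> V \<and>
     (\<forall>v\<in>V. \<exists>c. v - (\<Sum>b\<in>B. sc (c b) b) \<in> W) \<and>
     (\<forall>c. (\<Sum>b\<in>B. sc (c b) b) \<in> W \<longrightarrow> (\<forall>b\<in>B. c b = 0)))"

definition qdim :: "(complex \<Rightarrow> 'a \<Rightarrow> 'a) \<Rightarrow> 'a::ab_group_add set \<Rightarrow> 'a set \<Rightarrow> nat" where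
  "qdim sc V W = (if \<exists>n. has_qdim sc V W n then THE n. has_qdim sc V W n else 0)"

section \<open>Closed extensions\<close>

text \<open>Unbounded operators are represented by their graphs, which are saturated with respect to
  equality almost everywhere. \<open>formal_adjoint X m A \<phi> \<psi>\<close> means \<open>\<psi> = A\<^sup>\<star>\<phi>\<close> for the formal adjoint
  \<open>A\<^sup>\<star>\<close> of \<open>A\<close> with respect to \<open>ip\<close>, and \<open>(u, v) \<in> graph_max X m A\<close> means that \<open>u\<close>, \<open>v\<close> are in
  \<open>x\<^sup>-\<^sup>m\<^sup>/\<^sup>2 L\<^sup>2\<^sub>b\<close> and \<open>A u = v\<close> in the sense of distributions.\<close>

definition formal_adjoint ::
  "('p::topological_space, 'n::finite, 'r::finite) cone_data \<Rightarrow> nat \<Rightarrow> (('p, 'r) sec \<Rightarrow> ('p, 'r) sec) \<Rightarrow>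
     ('p, 'r) sec \<Rightarrow> ('p, 'r) sec \<Rightarrow> bool" where
  "formal_adjoint X m A \<phi> \<psi> \<longleftrightarrow> \<phi> \<in> test_sections X \<and> \<psi> \<in> test_sections X \<and>
     (\<forall>\<eta>\<in>test_sections X. ip X m (A \<eta>) \<phi> = ip X m \<eta> \<psi>)"

definition graph_max ::
  "('p::topological_space, 'n::finite, 'r::finite) cone_data \<Rightarrow> nat \<Rightarrow> (('p, 'r) sec \<Rightarrow> ('p, 'r) sec) \<Rightarrow>
     (('p, 'r) sec \<times> ('p, 'r) sec) set" where
  "graph_max X m A = {(u, v). u \<in> L2 X m \<and> v \<in> L2 X m \<and>
     (\<forall>\<phi> \<psi>. formal_adjoint X m A \<phi> \<psi> \<longrightarrow> ip X m u \<psi> = ip X m v \<phi>)}"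

definition D_max ::
  "('p::topological_space, 'n::finite, 'r::finite) cone_data \<Rightarrow> nat \<Rightarrow> (('p, 'r) sec \<Rightarrow> ('p, 'r) sec) \<Rightarrow>
     ('p, 'r) sec set" where
  "D_max X m A = Domain (graph_max X m A)"

definition D_min ::
  "('p::topological_space, 'n::finite, 'r::finite) cone_data \<Rightarrow> nat \<Rightarrow> (('p, 'r) sec \<Rightarrow> ('p, 'r) sec) \<Rightarrow>
     ('p, 'r) sec set" where
  "D_min X m A = {u\<in>L2 X m. \<exists>v\<in>L2 X m. \<exists>s :: nat \<Rightarrow> ('p, 'r) sec. (\<forall>k. s k \<in> test_sections X) \<and>
     (\<lambda>k. L2norm X m (s k - u)) \<longlonglongrightarrow> 0 \<and> (\<lambda>k. L2norm X m (A (s k) - v)) \<longlonglongrightarrow> 0}"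

text \<open>The graph of \<open>A\<^sub>\<D>\<close>.\<close>

definition A_on ::
  "('p::topological_space, 'n::finite, 'r::finite) cone_data \<Rightarrow> nat \<Rightarrow> (('p, 'r) sec \<Rightarrow> ('p, 'r) sec) \<Rightarrow>
     ('p, 'r) sec set \<Rightarrow> (('p, 'r) sec \<times> ('p, 'r) sec) set" where
  "A_on X m A \<D> = {(u, v)\<in>graph_max X m A. u \<in> \<D>}"

text \<open>\<open>dim ker - dim coker\<close>.\<close>

definition ind ::
  "('p::topological_space, 'n::finite, 'r::finite) cone_data \<Rightarrow> nat \<Rightarrow>
     (('p, 'r) sec \<times> ('p, 'r) sec) set \<Rightarrow> int" where
  "ind X m G = int (qdim scale_sec {u. (u, 0) \<in> G} (Null X m)) - int (qdim scale_sec (L2 X m) (Range G))"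

definition spec ::
  "('p::topological_space, 'n::finite, 'r::finite) cone_data \<Rightarrow> nat \<Rightarrow>
     (('p, 'r) sec \<times> ('p, 'r) sec) set \<Rightarrow> complex set" where
  "spec X m G = {\<zeta>. \<not> (
     {u. (u, scale_sec \<zeta> u) \<in> G} = Null X m \<and>
     {v - scale_sec \<zeta> u | u v. (u, v) \<in> G} = L2 X m \<and>
     (\<exists>C. \<forall>(u, v)\<in>G. L2norm X m u \<le> C * L2norm X m (v - scale_sec \<zeta> u)))}"

section \<open>The Grassmannian of domains\<close>

definition index_zero_domains ::
  "('p::topological_space, 'n::finite, 'r::finite) cone_data \<Rightarrow> nat \<Rightarrow> (('p, 'r) sec \<Rightarrow> ('p, 'r) sec) \<Rightarrow>
     ('p, 'r) sec set set" where
  "index_zero_domains X m A = {\<D>. module.subspace scale_sec \<D> \<and> D_min X m A \<subseteq> \<D> \<and> \<D> \<subseteq> D_max X m A \<and>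
     (\<exists>d. has_qdim scale_sec \<D> (D_min X m A) d \<and> int d = - ind X m (A_on X m A (D_min X m A)))}"

text \<open>Orthogonality for \<open>(u, w)\<^sub>A = (A u, A w) + (u, w)\<close>.\<close>

definition graph_orth ::
  "('p::topological_space, 'n::finite, 'r::finite) cone_data \<Rightarrow> nat \<Rightarrow> (('p, 'r) sec \<Rightarrow> ('p, 'r) sec) \<Rightarrow>
     ('p, 'r) sec \<Rightarrow> ('p, 'r) sec \<Rightarrow> bool" where
  "graph_orth X m A u w \<longleftrightarrow> (\<forall>v z. (u, v) \<in> graph_max X m A \<longrightarrow> (w, z) \<in> graph_max X m A \<longrightarrow>
     ip X m v z + ip X m u w = 0)"

definition E_max ::
  "('p::topological_space, 'n::finite, 'r::finite) cone_data \<Rightarrow> nat \<Rightarrow> (('p, 'r) sec \<Rightarrow> ('p, 'r) sec) \<Rightarrow>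
     ('p, 'r) sec set" where
  "E_max X m A = {u\<in>D_max X m A. \<forall>w\<in>D_min X m A. graph_orth X m A u w}"

text \<open>Linear maps \<open>U \<rightarrow> W\<close> preserving \<open>N\<close>, extended by \<open>0\<close> to the whole type.\<close>

definition Homs ::
  "('p, 'r::finite) sec set \<Rightarrow> ('p, 'r) sec set \<Rightarrow> ('p, 'r) sec set \<Rightarrow> (('p, 'r) sec \<Rightarrow> ('p, 'r) sec) set" where
  "Homs N U W = {T. (\<forall>u\<in>U. T u \<in> W) \<and> (\<forall>u\<in>U \<inter> N. T u \<in> N) \<and> (\<forall>u. u \<notin> U \<longrightarrow> T u = 0) \<and>
     (\<forall>u\<in>U. \<forall>u'\<in>U. T (u + u') = T u + T u') \<and> (\<forall>c. \<forall>u\<in>U. T (scale_sec c u) = scale_sec c (T u))}"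

text \<open>Complex dimension of \<open>\<GG>\<close> at \<open>\<D>\<close>. With \<open>U = \<D> \<inter> E_max\<close> and \<open>W\<close> the orthogonal complement of \<open>U\<close>
  in \<open>E_max\<close>, the standard chart of the Grassmannian around \<open>U\<close> is the inverse of
  \<open>T \<mapsto> {u + T u | u \<in> U}\<close>, \<open>T \<in> Hom(U, W)\<close>; the dimension is that of the model space \<open>Hom(U, W)\<close>.
  As sections equal almost everywhere are not identified, \<open>Hom(U/N, W/N)\<close> is expressed as
  \<open>Homs N U W / Homs N U N\<close> where \<open>N = Null\<close>.\<close>

definition local_dim ::
  "('p::topological_space, 'n::finite, 'r::finite) cone_data \<Rightarrow> nat \<Rightarrow> (('p, 'r) sec \<Rightarrow> ('p, 'r) sec) \<Rightarrow>
     ('p, 'r) sec set \<Rightarrow> nat" where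
  "local_dim X m A \<D> =
     (let N = Null X m; U = \<D> \<inter> E_max X m A; W = {u\<in>E_max X m A. \<forall>w\<in>U. graph_orth X m A u w}
      in qdim (\<lambda>c T u. scale_sec c (T u)) (Homs N U W) (Homs N U N))"

definition dim_domains ::
  "('p::topological_space, 'n::finite, 'r::finite) cone_data \<Rightarrow> nat \<Rightarrow> (('p, 'r) sec \<Rightarrow> ('p, 'r) sec) \<Rightarrow> nat" where
  "dim_domains X m A = (if index_zero_domains X m A = {} then 0
     else THE n. \<forall>\<D>\<in>index_zero_domains X m A. local_dim X m A \<D> = n)"

end

theory Submission
  imports Defs
begin

text \<open>If \<open>\<zeta>\<close> is in the resolvent set of \<open>A\<^sub>\<D>\<close> for a domain \<open>\<D> \<noteq> D_max\<close> of index zero, surjectivity of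
  \<open>A\<^sub>\<D> - \<zeta>\<close> corrects any element of \<open>D_max\<close> outside \<open>\<D>\<close> to an eigenvector \<open>x \<notin> \<D>\<close> of the maximal
  extension for \<open>\<zeta>\<close>. Since \<open>dim \<D>/D_min > 0\<close>, exchanging one basis vector of \<open>\<D>/D_min\<close> for \<open>x\<close> gives
  another domain of index zero, and it contains the eigenvector \<open>x\<close>.

  Positivity of \<open>dim \<GG>\<close> enters only through \<open>\<GG> \<noteq> {}\<close>, \<open>\<GG> \<noteq> {D_min}\<close> and \<open>\<GG> \<noteq> {D_max}\<close>: for a
  one-element \<open>\<GG>\<close> the definite description in \<open>dim_domains\<close> is certainly well-defined, and it is \<open>0\<close>
  in these two cases.\<close>

section \<open>Quotient dimensions\<close>

lemma sum_fun_scale_single: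
  fixes sc :: "complex \<Rightarrow> 'a::ab_group_add \<Rightarrow> 'a"
  assumes "vector_space sc" and "finite B" and "b \<in> B"
  shows "(\<Sum>y\<in>B. sc (if y = b then 1 else 0) y) = b"
proof -
  interpret vector_space sc by fact
  have "(\<Sum>y\<in>B. sc (if y = b then 1 else 0) y) = (\<Sum>y\<in>B. if y = b then y else 0)"
    by (rule sum.cong) auto
  then show ?thesis using assms by simp
qed

lemma has_qdim_exchange:
  fixes sc :: "complex \<Rightarrow> 'a::ab_group_add \<Rightarrow> 'a"
  assumes vs: "vector_space sc"
    and W: "module.subspace sc W" and V: "module.subspace sc V" and WV: "W \<subseteq> V"
    and dim: "has_qdim sc V W (Suc d)" and x: "x \<notin> V"
  obtains V' where "module.subspace sc V'" "W \<subseteq> V'" "x \<in> V'"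
    "V' \<subseteq> module.span sc (insert x V)" "has_qdim sc V' W (Suc d)"
proof -
  interpret vector_space sc by fact
  from dim obtain B where B: "finite B" "card B = Suc d" "B \<subseteq> V"
    and indep: "\<And>c b. (\<Sum>b\<in>B. sc (c b) b) \<in> W \<Longrightarrow> b \<in> B \<Longrightarrow> c b = 0"
    unfolding has_qdim_def by blast
  from B(2) obtain b0 where b0: "b0 \<in> B" by fastforce
  define B' where "B' = insert x (B - {b0})"
  have xB: "x \<notin> B" using x B by blast
  have B': "finite B'" "card B' = Suc d"
    using B b0 xB unfolding B'_def by (auto simp: card_insert_if)
  \<comment> \<open>This is \<open>W\<close> plus the span of \<open>B'\<close>, phrased so that the
    spanning clause of \<open>has_qdim\<close> holds by definition.\<close>
  define V' where "V' = {v. \<exists>c. v - (\<Sum>b\<in>B'. sc (c b) b) \<in> W}"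
  have WV': "W \<subseteq> V'"
    unfolding V'_def by (auto intro!: exI[of _ "\<lambda>_. 0"])
  have B'V': "B' \<subseteq> V'"
  proof
    fix b assume "b \<in> B'"
    then have "b - (\<Sum>y\<in>B'. sc (if y = b then 1 else 0) y) \<in> W"
      using sum_fun_scale_single[OF vs B'(1)] subspace_0[OF W] by simp
    then show "b \<in> V'" unfolding V'_def by (intro CollectI exI)
  qed
  have sub: "subspace V'"
  proof (rule subspaceI)
    show "0 \<in> V'" using WV' subspace_0[OF W] by blast
  next
    fix u v assume "u \<in> V'" "v \<in> V'"
    then obtain c c' where "u - (\<Sum>b\<in>B'. sc (c b) b) \<in> W" "v - (\<Sum>b\<in>B'. sc (c' b) b) \<in> W"
      unfolding V'_def by blast
    then have "(u - (\<Sum>b\<in>B'. sc (c b) b)) + (v - (\<Sum>b\<in>B'. sc (c' b) b)) \<in> W"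
      by (rule subspace_add[OF W])
    then have "(u + v) - (\<Sum>b\<in>B'. sc (c b + c' b) b) \<in> W"
      by (simp add: scale_left_distrib sum.distrib algebra_simps)
    then show "u + v \<in> V'" unfolding V'_def by (intro CollectI exI)
  next
    fix k v assume "v \<in> V'"
    then obtain c where "v - (\<Sum>b\<in>B'. sc (c b) b) \<in> W" unfolding V'_def by blast
    then have "sc k (v - (\<Sum>b\<in>B'. sc (c b) b)) \<in> W" by (rule subspace_scale[OF W])
    then have "sc k v - (\<Sum>b\<in>B'. sc (k * c b) b) \<in> W"
      by (simp add: scale_right_diff_distrib scale_sum_right)
    then show "sc k v \<in> V'" unfolding V'_def by (intro CollectI exI)
  qed
  have least: "V' \<subseteq> S" if S: "subspace S" "insert x V \<subseteq> S" for S
  proof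
    fix v assume "v \<in> V'"
    then obtain c where c: "v - (\<Sum>b\<in>B'. sc (c b) b) \<in> W" unfolding V'_def by blast
    have "B' \<subseteq> S" using S B unfolding B'_def by blast
    then have "(\<Sum>b\<in>B'. sc (c b) b) \<in> S"
      by (intro subspace_sum[OF S(1)] subspace_scale[OF S(1)]) blast
    then have "(v - (\<Sum>b\<in>B'. sc (c b) b)) + (\<Sum>b\<in>B'. sc (c b) b) \<in> S"
      using c WV S by (intro subspace_add[OF S(1)]) auto
    then show "v \<in> S" by simp
  qed
  have ind': "c b = 0" if c: "(\<Sum>b\<in>B'. sc (c b) b) \<in> W" and b: "b \<in> B'" for c b
  proof -
    have sum: "(\<Sum>b\<in>B'. sc (c b) b) = sc (c x) x + (\<Sum>b\<in>B - {b0}. sc (c b) b)"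
      unfolding B'_def using B xB by simp
    have rest: "(\<Sum>b\<in>B - {b0}. sc (c b) b) \<in> V"
      using B by (intro subspace_sum[OF V] subspace_scale[OF V]) blast
    \<comment> \<open>The whole relation is in \<open>W\<close> and hence in \<open>V\<close>, as is
      its part over \<open>B - {b0}\<close>; so the multiple of \<open>x\<close> is in
      \<open>V\<close> too, and a nonzero coefficient could be divided out to put \<open>x\<close>
      itself there.\<close>
    have "sc (c x) x \<in> V"
      using subspace_diff[OF V _ rest, of "\<Sum>b\<in>B'. sc (c b) b"] c WV sum by auto
    then have cx: "c x = 0"
      using subspace_scale[OF V, of "sc (c x) x" "inverse (c x)"] x by (cases "c x = 0") auto
    \<comment> \<open>Independence is known for families over all of \<open>B\<close>, so the
      surviving coefficients are extended by 0 at \<open>b0\<close>.\<close>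
    define c' where "c' = (\<lambda>b. if b = b0 then 0 else c b)"
    have "(\<Sum>b\<in>B. sc (c' b) b) = sc (c' b0) b0 + (\<Sum>b\<in>B - {b0}. sc (c' b) b)"
      using B b0 by (simp add: sum.remove)
    also have "\<dots> = (\<Sum>b\<in>B - {b0}. sc (c b) b)"
      unfolding c'_def by (auto intro!: sum.cong)
    finally have "(\<Sum>b\<in>B. sc (c' b) b) \<in> W" using c sum cx by simp
    then have "c' b = 0" if "b \<in> B - {b0}" for b
      using indep[of c'] that by blast
    then have "c b = 0" if "b \<in> B - {b0}" for b
      using that unfolding c'_def by force
    then show ?thesis using b cx unfolding B'_def by blast
  qed
  have "has_qdim sc V' W (Suc d)"
    unfolding has_qdim_def using B' B'V' ind' by (intro exI[of _ B']) (auto simp: V'_def)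
  moreover have "x \<in> V'" using B'V' unfolding B'_def by blast
  moreover have "V' \<subseteq> span (insert x V)" by (intro least subspace_span span_superset)
  ultimately show thesis using that sub WV' by blast
qed

text \<open>\<open>qdim\<close> is a definite description, so 0 must also be shown to be the only
  possible dimension: the indicator of a representative \<open>b\<close> gives a combination equal
  to \<open>b\<close>, which lies in \<open>W\<close>, and independence would force 1 = 0. Asking
  only for the laws of \<open>sc\<close> at 1 and 0 makes the lemma directly applicable to the
  pointwise scaling of maps in \<open>Homs\<close>.\<close>

lemma qdim_eq_0:
  fixes sc :: "complex \<Rightarrow> 'a::ab_group_add \<Rightarrow> 'a"
  assumes VW: "V \<subseteq> W" and sc1: "\<And>v. sc 1 v = v" and sc0: "\<And>v. sc 0 v = 0"
  shows "qdim sc V W = 0"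
proof -
  have h0: "has_qdim sc V W 0"
    unfolding has_qdim_def using VW by (intro exI[of _ "{}"]) auto
  have "n = 0" if n: "has_qdim sc V W n" for n
  proof -
    from n obtain B where B: "finite B" "card B = n" "B \<subseteq> V"
      and ind: "\<And>c b. (\<Sum>b\<in>B. sc (c b) b) \<in> W \<Longrightarrow> b \<in> B \<Longrightarrow> c b = 0"
      unfolding has_qdim_def by blast
    have "False" if "b \<in> B" for b
    proof -
      have "(\<Sum>y\<in>B. sc (if y = b then 1 else 0) y) = (\<Sum>y\<in>B. if y = b then y else 0)"
        by (rule sum.cong) (auto simp: sc1 sc0)
      then have "(\<Sum>y\<in>B. sc (if y = b then 1 else 0) y) \<in> W"
        using that B VW by auto
      from ind[OF this that] show False by simp
    qed
    then show ?thesis using B by auto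
  qed
  with h0 show ?thesis unfolding qdim_def by auto
qed

section \<open>Smooth functions\<close>

text \<open>On an open set, agreement of functions entails agreement of their derivatives, so the
  induction can pass to directional derivatives.\<close>

lemma Ck_on_cong:
  assumes "open S" and "\<And>x. x \<in> S \<Longrightarrow> f x = g x" and "Ck_on k f S"
  shows "Ck_on k g S"
  using assms
proof (induction k arbitrary: f g)
  case 0
  then show ?case by (auto cong: continuous_on_cong)
next
  case (Suc k)
  have deriv: "frechet_derivative g (at x) = frechet_derivative f (at x)" if "x \<in> S" for x
  proof -
    \<comment> \<open>\<open>frechet_derivative\<close> chooses one of the derivatives, so it is
      enough that \<open>f\<close> and \<open>g\<close> have the same ones.\<close>
    have "(f has_derivative D) (at x) \<longleftrightarrow> (g has_derivative D) (at x)" for D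
      using has_derivative_transform_within_open[of f D x UNIV S g]
        has_derivative_transform_within_open[of g D x UNIV S f] Suc.prems that by auto
    then show ?thesis unfolding frechet_derivative_def by simp
  qed
  have "g differentiable_on S"
    unfolding differentiable_on_def
  proof
    fix x assume x: "x \<in> S"
    then show "g differentiable at x within S"
      using Suc.prems by (intro differentiable_transform_within[of f x S 1 g])
        (auto simp: differentiable_on_def)
  qed
  moreover have "Ck_on k (\<lambda>x. frechet_derivative g (at x) v) S" for v
    by (rule Suc.IH[of "\<lambda>x. frechet_derivative f (at x) v"]) (use Suc.prems deriv in auto)
  ultimately show ?case by simp
qed

text \<open>The formula for the derivative of a sum is available only at points of \<open>S\<close>,
  where both functions are differentiable; \<open>Ck_on_cong\<close> absorbs what happens
  elsewhere.\<close>

lemma Ck_on_add: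
  assumes "open S" and "Ck_on k f S" and "Ck_on k g S"
  shows "Ck_on k (\<lambda>x. f x + g x) S"
  using assms
proof (induction k arbitrary: f g)
  case 0
  then show ?case by (auto intro: continuous_on_add)
next
  case (Suc k)
  have diff: "f differentiable (at x)" "g differentiable (at x)" if "x \<in> S" for x
    using Suc.prems that differentiable_on_eq_differentiable_at[OF Suc.prems(1)] by auto
  have "Ck_on k (\<lambda>x. frechet_derivative (\<lambda>x. f x + g x) (at x) v) S" for v
  proof (rule Ck_on_cong[OF Suc.prems(1)])
    show "Ck_on k (\<lambda>x. frechet_derivative f (at x) v + frechet_derivative g (at x) v) S"
      using Suc by auto
    fix x assume "x \<in> S"
    then show "frechet_derivative f (at x) v + frechet_derivative g (at x) v =
        frechet_derivative (\<lambda>x. f x + g x) (at x) v"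
      using diff by (auto intro!: fun_cong[OF frechet_derivative_at, of _ _ x v] has_derivative_add
          simp flip: frechet_derivative_works)
  qed
  moreover have "(\<lambda>x. f x + g x) differentiable_on S"
    using diff by (auto simp: differentiable_on_eq_differentiable_at[OF Suc.prems(1)]
        intro: differentiable_add)
  ultimately show ?case by simp
qed

lemma Ck_on_bounded_linear:
  assumes L: "bounded_linear L" and "open S" and "Ck_on k f S"
  shows "Ck_on k (\<lambda>x. L (f x)) S"
  using assms(2,3)
proof (induction k arbitrary: f)
  case 0
  then show ?case by (auto intro: bounded_linear.continuous_on[OF L])
next
  case (Suc k)
  have deriv: "((\<lambda>x. L (f x)) has_derivative (\<lambda>v. L (frechet_derivative f (at x) v))) (at x)"
    if "x \<in> S" for x
    using Suc.prems that differentiable_on_eq_differentiable_at[OF Suc.prems(1)]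
    by (intro bounded_linear.has_derivative[OF L]) (auto simp: frechet_derivative_works)
  have "Ck_on k (\<lambda>x. frechet_derivative (\<lambda>x. L (f x)) (at x) v) S" for v
  proof (rule Ck_on_cong[OF Suc.prems(1)])
    show "Ck_on k (\<lambda>x. L (frechet_derivative f (at x) v)) S"
      using Suc by auto
    show "L (frechet_derivative f (at x) v) = frechet_derivative (\<lambda>x. L (f x)) (at x) v"
      if "x \<in> S" for x
      using frechet_derivative_at[OF deriv[OF that]] by metis
  qed
  moreover have "(\<lambda>x. L (f x)) differentiable_on S"
    using deriv Suc.prems(1) differentiable_on_eq_differentiable_at
    unfolding differentiable_def by (metis differentiable_def)
  ultimately show ?case by simp
qed

text \<open>Near each point \<open>f\<close> agrees on \<open>S\<close> with an extension that is
  continuous on an open neighbourhood, and continuity within \<open>S\<close> is local.\<close>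

lemma smooth_on_imp_continuous_on:
  assumes "smooth_on S f"
  shows "continuous_on S f"
  unfolding continuous_on_eq_continuous_within
proof
  fix p assume p: "p \<in> S"
  from assms p obtain V g where V: "open V" "p \<in> V" and "\<forall>k. Ck_on k g V"
    and eq: "\<forall>q\<in>V \<inter> S. f q = g q"
    unfolding smooth_on_def by blast
  then have "Ck_on 0 g V" by blast
  then have "continuous_on (V \<inter> S) g" by (auto intro: continuous_on_subset)
  then have "continuous_on (V \<inter> S) f"
    using continuous_on_cong[of "V \<inter> S" "V \<inter> S" f g] eq by simp
  then have "continuous (at p within V \<inter> S) f"
    using p V by (auto simp: continuous_on_eq_continuous_within)
  moreover have "at p within V \<inter> S = at p within S"
    using at_within_nhd[of p V "V \<inter> S" S] V by auto
  ultimately show "continuous (at p within S) f" by simp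
qed

lemma smooth_on_add:
  assumes "smooth_on S f" and "smooth_on S g"
  shows "smooth_on S (\<lambda>x. f x + g x)"
  unfolding smooth_on_def
proof
  fix p assume p: "p \<in> S"
  obtain V f' where f: "open V" "p \<in> V" "\<forall>k. Ck_on k f' V" "\<forall>q\<in>V \<inter> S. f q = f' q"
    using assms(1) p unfolding smooth_on_def by blast
  obtain V' g' where g: "open V'" "p \<in> V'" "\<forall>k. Ck_on k g' V'" "\<forall>q\<in>V' \<inter> S. g q = g' q"
    using assms(2) p unfolding smooth_on_def by blast
  \<comment> \<open>The local extensions of \<open>f\<close> and \<open>g\<close> live on different
    neighbourhoods and have to be restricted to the intersection before they are added.\<close>
  have sub: "Ck_on k h T" if "Ck_on k h T'" "T \<subseteq> T'" for k T T' and h :: "'a \<Rightarrow> 'b"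
    using that
  proof (induction k arbitrary: h)
    case 0
    then show ?case by (auto intro: continuous_on_subset)
  next
    case (Suc k)
    then show ?case by (auto intro: differentiable_on_subset)
  qed
  have "Ck_on k (\<lambda>x. f' x + g' x) (V \<inter> V')" for k
    using f g by (intro Ck_on_add) (auto intro: sub)
  then show "\<exists>V h. open V \<and> p \<in> V \<and> (\<forall>k. Ck_on k h V) \<and> (\<forall>q\<in>V \<inter> S. f q + g q = h q)"
    using f g by (intro exI[of _ "V \<inter> V'"] exI[of _ "\<lambda>x. f' x + g' x"]) auto
qed

lemma smooth_on_bounded_linear:
  assumes "bounded_linear L" and "smooth_on S f"
  shows "smooth_on S (\<lambda>x. L (f x))"
  unfolding smooth_on_def
proof
  fix p assume "p \<in> S"
  then obtain V g where "open V" "p \<in> V" "\<forall>k. Ck_on k g V" "\<forall>q\<in>V \<inter> S. f q = g q"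
    using assms(2) unfolding smooth_on_def by blast
  then show "\<exists>V h. open V \<and> p \<in> V \<and> (\<forall>k. Ck_on k h V) \<and> (\<forall>q\<in>V \<inter> S. L (f q) = h q)"
    by (intro exI[of _ V] exI[of _ "\<lambda>x. L (g x)"]) (auto intro: Ck_on_bounded_linear[OF assms(1)])
qed

lemma smooth_on_const: "smooth_on S (\<lambda>_. c)"
proof -
  \<comment> \<open>The constant is generalised because the derivative is again a constant function,
    with value 0.\<close>
  have "Ck_on k (\<lambda>_. c :: 'b) (UNIV :: 'a set)" for k and c :: 'b
    by (induction k arbitrary: c) (auto simp: frechet_derivative_const)
  then show ?thesis unfolding smooth_on_def by (intro ballI exI[of _ UNIV] exI[of _ "\<lambda>_. c"]) auto
qed

lemma msmooth_on_add:
  "msmooth_on X V f \<Longrightarrow> msmooth_on X V g \<Longrightarrow> msmooth_on X V (\<lambda>p. f p + g p)"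
  unfolding msmooth_on_def o_def by (auto intro!: smooth_on_add)

lemma msmooth_on_bounded_linear:
  "bounded_linear L \<Longrightarrow> msmooth_on X V f \<Longrightarrow> msmooth_on X V (\<lambda>p. L (f p))"
  using smooth_on_bounded_linear[of L _ "\<lambda>v. f (inv_into _ _ v)"]
  unfolding msmooth_on_def o_def by blast

text \<open>Charts are homeomorphisms, so \<open>f\<close> is locally its smooth coordinate
  expression composed with a chart; the open chart domains cover the manifold, and continuity glues
  over open sets.\<close>

lemma msmooth_on_imp_continuous_on:
  fixes X :: "('p::topological_space, 'n::finite, 'r::finite) cone_data"
  assumes "smooth_atlas X" and V: "open V" and f: "msmooth_on X V f"
  shows "continuous_on V f"
proof -
  have chart: "continuous_on (U \<inter> V) f" "open U" if "(U, \<phi>) \<in> atlas X" for U \<phi>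
  proof -
    have c: "open U" "homeomorphism U (\<phi> ` U) \<phi> (inv_into U \<phi>)"
      using that assms unfolding smooth_atlas_def is_chart_def by auto
    show "open U" by fact
    have "continuous_on (\<phi> ` (U \<inter> V)) (f \<circ> inv_into U \<phi>)"
      using f that unfolding msmooth_on_def by (intro smooth_on_imp_continuous_on) auto
    moreover have "continuous_on (U \<inter> V) \<phi>"
      using homeomorphism_cont1[OF c(2)] by (rule continuous_on_subset) auto
    ultimately have "continuous_on (U \<inter> V) ((f \<circ> inv_into U \<phi>) \<circ> \<phi>)"
      by (rule continuous_on_compose[rotated])
    then show "continuous_on (U \<inter> V) f"
      by (rule continuous_on_cong[THEN iffD1, rotated -1, OF _ refl])
        (use homeomorphism_apply1[OF c(2)] in auto)
  qed
  have "(\<Union>c\<in>atlas X. fst c \<inter> V) = V"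
    using assms unfolding smooth_atlas_def by auto
  moreover have "continuous_on (\<Union>c\<in>atlas X. fst c \<inter> V) f"
    by (rule continuous_on_open_UN) (use chart V in auto)
  ultimately show ?thesis by simp
qed

section \<open>Hermitian sections\<close>

lemma vector_space_scale_sec: "vector_space (scale_sec :: complex \<Rightarrow> ('p, 'r::finite) sec \<Rightarrow> _)"
  by standard
    (auto simp: scale_sec_def fun_eq_iff vector_add_ldistrib vector_sadd_rdistrib vector_smult_assoc)

interpretation sec: vector_space "scale_sec :: complex \<Rightarrow> ('p, 'r::finite) sec \<Rightarrow> _"
  by (rule vector_space_scale_sec)

text \<open>The measurability clause of \<open>L2\<close> on its own. It refers to trivialisations
  because the bare identification of the fibres may be discontinuous in the base point.\<close>

definition meas_sec :: "('p::topological_space, 'n::finite, 'r::finite) cone_data \<Rightarrow> ('p, 'r) sec \<Rightarrow> bool" where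
  "meas_sec X u \<longleftrightarrow>
     (\<forall>(V, \<tau>)\<in>trivs X. (\<lambda>p. \<tau> p *v u p) \<in> borel_measurable (restrict_space borel V))"

text \<open>Complex scaling is linear over the reals; smoothness and measurability of sections pass
  through it for this reason.\<close>

lemma bounded_linear_smult_vec: "bounded_linear (\<lambda>v :: complex^'r::finite. c *s v)"
  by (rule linear_conv_bounded_linear[THEN iffD1])
    (auto intro!: linearI simp: vec_eq_iff algebra_simps)

lemma meas_sec_add: "meas_sec X u \<Longrightarrow> meas_sec X v \<Longrightarrow> meas_sec X (u + v)"
  unfolding meas_sec_def by (fastforce simp: matrix_vector_right_distrib)

lemma meas_sec_scale_sec:
  assumes "meas_sec X u"
  shows "meas_sec X (scale_sec c u)"
  unfolding meas_sec_def
proof safe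
  fix V \<tau> assume "(V, \<tau>) \<in> trivs X"
  then have "(\<lambda>p. \<tau> p *v u p) \<in> borel_measurable (restrict_space borel V)"
    using assms unfolding meas_sec_def by auto
  then have "(\<lambda>p. c *s (\<tau> p *v u p)) \<in> borel_measurable (restrict_space borel V)"
    by (rule measurable_compose[OF _ borel_measurable_continuous_onI[OF linear_continuous_on[OF
      bounded_linear_smult_vec]]])
  then show "(\<lambda>p. \<tau> p *v scale_sec c u p) \<in> borel_measurable (restrict_space borel V)"
    by (simp add: scale_sec_def vector_scalar_commute)
qed

locale cone =
  fixes X :: "('p::t2_space, 'n::finite, 'r::finite) cone_data" and m :: nat
  assumes geometry: "cone_geometry X"
begin

lemma smooth: "smooth_atlas X" and compact_UNIV: "compact (UNIV :: 'p set)"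
  and vbundle: "vector_bundle X" and metric: "hermitian_metric X"
  and bdf: "boundary_defining X" and b_dens: "b_density X"
  using geometry unfolding cone_geometry_def by auto

section \<open>Pointwise algebra and inequalities of the fibre metric\<close>

lemma herm_add_left: "herm X p (a + b) c = herm X p a c + herm X p b c"
  and herm_scale_left: "herm X p (z *s a) b = z * herm X p a b"
  and herm_pos: "a \<noteq> 0 \<Longrightarrow> 0 < Re (herm X p a a)"
  using metric unfolding hermitian_metric_def by blast+

lemma herm_cnj: "cnj (herm X p a b) = herm X p b a"
proof -
  have "herm X p b a = cnj (herm X p a b)"
    using metric unfolding hermitian_metric_def by blast
  then show ?thesis by simp
qed

lemma herm_add_right: "herm X p c (a + b) = herm X p c a + herm X p c b"
  by (metis herm_add_left herm_cnj complex_cnj_add)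

lemma herm_scale_right: "herm X p b (z *s a) = cnj z * herm X p b a"
  by (metis herm_scale_left herm_cnj complex_cnj_mult)

lemma herm_zero_left [simp]: "herm X p 0 b = 0"
  using herm_scale_left[of p 0 0 b] by simp

lemma herm_zero_right [simp]: "herm X p b 0 = 0"
  using herm_scale_right[of p b 0 0] by simp

lemma herm_minus_left: "herm X p (- a) b = - herm X p a b"
  using herm_scale_left[of p "-1" a b] by simp

lemma herm_minus_right: "herm X p b (- a) = - herm X p b a"
  using herm_scale_right[of p b "-1" a] by simp

lemma herm_diff_left: "herm X p (a - b) c = herm X p a c - herm X p b c"
  using herm_add_left[of p a "- b" c] by (simp add: herm_minus_left)

lemma herm_diff_right: "herm X p c (a - b) = herm X p c a - herm X p c b"
  using herm_add_right[of p c a "- b"] by (simp add: herm_minus_right)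

lemma herm_sum_left: "herm X p (\<Sum>i\<in>I. f i) b = (\<Sum>i\<in>I. herm X p (f i) b)"
  by (induction I rule: infinite_finite_induct) (auto simp: herm_add_left)

lemma herm_sum_right: "herm X p b (\<Sum>i\<in>I. f i) = (\<Sum>i\<in>I. herm X p b (f i))"
  by (induction I rule: infinite_finite_induct) (auto simp: herm_add_right)

lemma herm_nonneg: "0 \<le> Re (herm X p a a)"
  using herm_pos[of a p] by (cases "a = 0") auto

text \<open>A weak Cauchy-Schwarz inequality without square roots, ready to serve as an integrable
  majorant. Rotating \<open>a\<close> by a unimodular \<open>w\<close> makes the product real and
  nonnegative; then positivity at \<open>w *s a - b\<close> is expanded.\<close>

lemma norm_herm_le: "norm (herm X p a b) \<le> Re (herm X p a a) + Re (herm X p b b)"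
proof (cases "herm X p a b = 0")
  case True
  then show ?thesis using herm_nonneg[of p a] herm_nonneg[of p b] by simp
next
  case False
  define z where "z = herm X p a b"
  \<comment> \<open>The conjugate phase of the product, unimodular because the product is nonzero in
    this case.\<close>
  define w where "w = cnj (sgn z)"
  have wz: "w * z = complex_of_real (norm z)"
    using False unfolding w_def z_def[symmetric]
    by (simp add: sgn_div_norm scaleR_conv_of_real complex_norm_square[symmetric] field_simps power2_eq_square)
  have ww: "w * cnj w = 1"
    using False unfolding w_def z_def[symmetric]
    by (simp add: complex_norm_square[symmetric] mult.commute norm_sgn)
  have "herm X p (w *s a - b) (w *s a - b) =
      w * cnj w * herm X p a a + herm X p b b - (w * z + cnj (w * z))"
    by (simp add: herm_diff_left herm_diff_right herm_scale_left herm_scale_right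
        z_def herm_cnj algebra_simps)
  then have "herm X p (w *s a - b) (w *s a - b) =
      herm X p a a + herm X p b b - 2 * complex_of_real (norm z)"
    unfolding ww wz by simp
  from arg_cong[where f = Re, OF this] have "2 * norm z \<le> Re (herm X p a a) + Re (herm X p b b)"
    using herm_nonneg[of p "w *s a - b"] by simp
  then show ?thesis unfolding z_def using norm_ge_zero[of "herm X p a b"] by linarith
qed

text \<open>The parallelogram law with the nonnegative term of \<open>a - b\<close> dropped.\<close>

lemma herm_add_le:
  "Re (herm X p (a + b) (a + b)) \<le> 2 * Re (herm X p a a) + 2 * Re (herm X p b b)"
proof -
  have "Re (herm X p (a + b) (a + b)) + Re (herm X p (a - b) (a - b)) =
      2 * Re (herm X p a a) + 2 * Re (herm X p b b)"
    by (simp add: herm_add_left herm_add_right herm_diff_left herm_diff_right)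
  then show ?thesis using herm_nonneg[of p "a - b"] by linarith
qed

section \<open>Measurability of Hermitian products through local frames\<close>

lemma trivs_open: "(V, \<tau>) \<in> trivs X \<Longrightarrow> open V"
  and trivs_invertible: "(V, \<tau>) \<in> trivs X \<Longrightarrow> p \<in> V \<Longrightarrow> invertible (\<tau> p)"
  and trivs_cover: "\<Union>(fst ` trivs X) = UNIV"
  using vbundle unfolding vector_bundle_def by auto

text \<open>Expansion in the frame given by the inverse trivialisation. It separates the components
  of the sections, whose measurability is known, from the Gram matrix of the frame, which is
  continuous; the product itself in bare fibre coordinates has no such regularity to start
  from.\<close>

lemma herm_local_frame:
  assumes "(V, \<tau>) \<in> trivs X" and "p \<in> V"
  shows "herm X p a b = (\<Sum>i\<in>UNIV. \<Sum>j\<in>UNIV. (\<tau> p *v a) $ i * cnj ((\<tau> p *v b) $ j) *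
    herm X p (matrix_inv (\<tau> p) *v axis i 1) (matrix_inv (\<tau> p) *v axis j 1))"
proof -
  have mult_sum: "B *v (\<Sum>i\<in>I. f i) = (\<Sum>i\<in>I. B *v f i)"
    for B :: "complex^'r^'r" and f :: "'r \<Rightarrow> complex^'r" and I
    by (induction I rule: infinite_finite_induct) (auto simp: matrix_vector_right_distrib)
  have frame: "a = (\<Sum>i\<in>UNIV. (\<tau> p *v a) $ i *s (matrix_inv (\<tau> p) *v axis i 1))" for a
  proof -
    have "a = matrix_inv (\<tau> p) *v (\<tau> p *v a)"
      using someI_ex[OF trivs_invertible[OF assms, unfolded invertible_def]]
      by (simp add: matrix_vector_mul_assoc matrix_inv_def)
    also have "\<tau> p *v a = (\<Sum>i\<in>UNIV. (\<tau> p *v a) $ i *s axis i 1)"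
      by (simp add: basis_expansion)
    also have "matrix_inv (\<tau> p) *v \<dots> = (\<Sum>i\<in>UNIV. (\<tau> p *v a) $ i *s (matrix_inv (\<tau> p) *v axis i 1))"
      by (simp add: mult_sum vector_scalar_commute)
    finally show ?thesis .
  qed
  have "herm X p a b = herm X p (\<Sum>i\<in>UNIV. (\<tau> p *v a) $ i *s (matrix_inv (\<tau> p) *v axis i 1))
      (\<Sum>j\<in>UNIV. (\<tau> p *v b) $ j *s (matrix_inv (\<tau> p) *v axis j 1))"
    by (simp only: frame[symmetric])
  then show ?thesis
    by (simp only: herm_sum_left) (simp add: herm_sum_right herm_scale_left herm_scale_right mult_ac)
qed

lemma continuous_on_herm_frame:
  assumes "(V, \<tau>) \<in> trivs X"
  shows "continuous_on V (\<lambda>p. herm X p (matrix_inv (\<tau> p) *v a) (matrix_inv (\<tau> p) *v b))"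
proof -
  have "\<forall>(V, \<tau>)\<in>trivs X. \<forall>a b.
      msmooth_on X V (\<lambda>p. herm X p (matrix_inv (\<tau> p) *v a) (matrix_inv (\<tau> p) *v b))"
    using metric unfolding hermitian_metric_def by (rule conjunct2)
  then show ?thesis
    using assms by (intro msmooth_on_imp_continuous_on[OF smooth trivs_open[OF assms]]) auto
qed

lemma borel_measurable_herm:
  assumes "meas_sec X u" and "meas_sec X v"
  shows "(\<lambda>p. herm X p (u p) (v p)) \<in> borel_measurable borel"
proof -
  \<comment> \<open>Measurability is known over each trivialisation, and gluing it needs a countable
    cover; compactness of the manifold supplies a finite one.\<close>
  obtain C where C: "C \<subseteq> fst ` trivs X" "finite C" "UNIV \<subseteq> \<Union>C"
  proof (rule compactE[OF compact_UNIV])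
    show "UNIV \<subseteq> \<Union>(fst ` trivs X)" using trivs_cover by simp
    show "open V" if "V \<in> fst ` trivs X" for V using that trivs_open by auto
  qed
  have loc: "(\<lambda>p. herm X p (u p) (v p)) \<in> borel_measurable (restrict_space borel V)"
    if t: "(V, \<tau>) \<in> trivs X" for V \<tau>
  proof -
    have comp: "(\<lambda>p. (\<tau> p *v s p) $ i) \<in> borel_measurable (restrict_space borel V)"
      if "meas_sec X s" for s i
    proof (rule measurable_compose[where f = "\<lambda>p. \<tau> p *v s p" and g = "\<lambda>v. v $ i"])
      show "(\<lambda>p. \<tau> p *v s p) \<in> borel_measurable (restrict_space borel V)"
        using that t unfolding meas_sec_def by auto
      show "(\<lambda>v. v $ i) \<in> borel_measurable borel"
        by (intro borel_measurable_continuous_onI continuous_intros)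
    qed
    have cont: "(\<lambda>p. herm X p (matrix_inv (\<tau> p) *v a) (matrix_inv (\<tau> p) *v b))
        \<in> borel_measurable (restrict_space borel V)" for a b
      by (intro borel_measurable_continuous_on_restrict continuous_on_herm_frame[OF t])
    have cnj_meas: "cnj \<in> borel_measurable borel"
      by (intro borel_measurable_continuous_onI continuous_intros)
    have "(\<lambda>p. \<Sum>i\<in>UNIV. \<Sum>j\<in>UNIV. (\<tau> p *v u p) $ i * cnj ((\<tau> p *v v p) $ j) *
        herm X p (matrix_inv (\<tau> p) *v axis i 1) (matrix_inv (\<tau> p) *v axis j 1))
        \<in> borel_measurable (restrict_space borel V)"
      by (intro borel_measurable_sum borel_measurable_times cont comp assms
          measurable_compose[OF _ cnj_meas])
    then show ?thesis
      by (rule measurable_cong[THEN iffD1, rotated])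
        (auto simp: space_restrict_space herm_local_frame[OF t])
  qed
  show ?thesis
  proof (rule measurable_piecewise_restrict)
    show "countable C" using C(2) by (rule countable_finite)
    show "space borel \<subseteq> \<Union>C" using C(3) by simp
    fix V assume "V \<in> C"
    then obtain \<tau> where t: "(V, \<tau>) \<in> trivs X" using C(1) by fastforce
    show "V \<inter> space borel \<in> sets borel" using trivs_open[OF t] by simp
    show "(\<lambda>p. herm X p (u p) (v p)) \<in> borel_measurable (restrict_space borel V)"
      using loc[OF t] .
  qed
qed

section \<open>Finiteness of the density on compact subsets of the interior\<close>

lemma continuous_on_bdf: "continuous_on UNIV (bdf X)"
  using bdf by (intro msmooth_on_imp_continuous_on[OF smooth]) (auto simp: boundary_defining_def)

lemma bdf_nonneg: "0 \<le> bdf X p" and bdf_eq_0_iff: "bdf X p = 0 \<longleftrightarrow> p \<in> bdry X"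
  using bdf unfolding boundary_defining_def by auto

lemma open_interior: "open (interior_part X)"
proof -
  have "interior_part X = {p. bdf X p \<noteq> 0}" by (auto simp: bdf_eq_0_iff)
  then show ?thesis by (auto intro: open_Collect_neq continuous_on_bdf)
qed

lemma sets_dens [measurable_cong]: "sets (dens X) = sets borel"
  using b_dens unfolding b_density_def by auto

lemma sets_wmeas [measurable_cong]: "sets (wmeas X m) = sets borel"
  unfolding wmeas_def by (simp add: sets_dens)

lemma bdf_measurable [measurable]: "bdf X \<in> borel_measurable borel"
  by (intro borel_measurable_continuous_onI continuous_on_bdf)

text \<open>In a chart the measure is a density against Lebesgue measure that is continuous away
  from the boundary, where \<open>bdf\<close> vanishes. Around an interior point it is bounded on a
  neighbourhood whose chart image has finite volume.\<close>

lemma dens_locally_finite: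
  assumes p: "p \<in> interior_part X"
  obtains B where "open B" "p \<in> B" "emeasure (dens X) B < \<infinity>"
proof -
  obtain U \<phi> where c: "(U, \<phi>) \<in> atlas X" "p \<in> U"
  proof -
    have "p \<in> \<Union>(fst ` atlas X)" using smooth unfolding smooth_atlas_def by simp
    then show thesis using that by fastforce
  qed
  then have U: "open U" "openin (top_of_set (halfspace (nidx X))) (\<phi> ` U)"
    "homeomorphism U (\<phi> ` U) \<phi> (inv_into U \<phi>)"
    using smooth unfolding smooth_atlas_def is_chart_def by auto
  obtain \<rho> where \<rho>: "density_in_chart X (U, \<phi>) \<rho>" using b_dens c unfolding b_density_def by blast
  have inv: "inv_into U \<phi> (\<phi> q) = q" if "q \<in> U" for q
    using homeomorphism_apply1[OF U(3) that] .
  have cont: "continuous_on (U \<inter> interior_part X) (\<lambda>q. \<rho> (\<phi> q) / bdf X q)"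
  proof (intro continuous_on_divide)
    have "continuous_on (\<phi> ` U) \<rho>"
      using \<rho> unfolding density_in_chart_def by (auto intro: smooth_on_imp_continuous_on)
    then show "continuous_on (U \<inter> interior_part X) (\<lambda>q. \<rho> (\<phi> q))"
      by (rule continuous_on_compose2)
        (use homeomorphism_cont1[OF U(3)] in \<open>auto intro: continuous_on_subset\<close>)
  qed (use bdf_eq_0_iff continuous_on_bdf in \<open>auto intro: continuous_on_subset\<close>)
  \<comment> \<open>Exceeding the value at \<open>p\<close> by 1 turns the bound into a strict
    inequality that holds at \<open>p\<close> and hence on an open set; the distance condition puts
    the chart image in a unit ball.\<close>
  define C where "C = \<rho> (\<phi> p) / bdf X p + 1"
  define B where "B = {q \<in> U \<inter> interior_part X. \<rho> (\<phi> q) / bdf X q < C \<and> dist (\<phi> q) (\<phi> p) < 1}"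
  have "continuous_on (U \<inter> interior_part X) (\<lambda>q. dist (\<phi> q) (\<phi> p))"
    using homeomorphism_cont1[OF U(3)]
    by (intro continuous_intros) (auto intro: continuous_on_subset)
  then have "open ((U \<inter> interior_part X) \<inter> (\<lambda>q. dist (\<phi> q) (\<phi> p)) -` {..<1})"
      "open ((U \<inter> interior_part X) \<inter> (\<lambda>q. \<rho> (\<phi> q) / bdf X q) -` {..<C})"
    using cont U open_interior by (auto intro!: continuous_open_preimage)
  moreover have "B = ((U \<inter> interior_part X) \<inter> (\<lambda>q. dist (\<phi> q) (\<phi> p)) -` {..<1})
      \<inter> ((U \<inter> interior_part X) \<inter> (\<lambda>q. \<rho> (\<phi> q) / bdf X q) -` {..<C})"
    unfolding B_def by auto
  ultimately have B: "open B" by auto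
  have "emeasure (dens X) B = (\<integral>\<^sup>+v\<in>\<phi> ` B. ennreal (\<rho> v / bdf X (inv_into U \<phi> v)) \<partial>lborel)"
  proof -
    have "B \<in> sets borel" "B \<subseteq> U \<inter> interior_part X"
      using B unfolding B_def by auto
    then show ?thesis using \<rho> unfolding density_in_chart_def by blast
  qed
  also have "\<dots> \<le> (\<integral>\<^sup>+v. ennreal C * indicator (ball (\<phi> p) 1) v \<partial>lborel)"
    by (intro nn_integral_mono)
      (auto simp: B_def inv dist_commute split: split_indicator intro!: ennreal_leI)
  also have "\<dots> = ennreal C * emeasure lborel (ball (\<phi> p) 1)"
    by (subst nn_integral_cmult_indicator) auto
  also have "\<dots> < \<infinity>"
    using emeasure_lborel_ball_finite[of "\<phi> p" 1] by (simp add: ennreal_mult_less_top)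
  finally have "emeasure (dens X) B < \<infinity>" .
  moreover have "p \<in> B" using p c unfolding B_def C_def by auto
  ultimately show thesis using that B by blast
qed

text \<open>Finitely many neighbourhoods of finite measure cover \<open>K\<close>, and the weight
  \<open>bdf X p ^ m\<close> is bounded on it.\<close>

lemma wmeas_compact_finite:
  assumes K: "compact K" "K \<subseteq> interior_part X"
  shows "emeasure (wmeas X m) K < \<infinity>"
proof -
  have "\<exists>B. open B \<and> p \<in> B \<and> emeasure (dens X) B < \<infinity>" if "p \<in> K" for p
    using dens_locally_finite[of p] that K(2) by blast
  then obtain B where B: "\<And>p. p \<in> K \<Longrightarrow> open (B p) \<and> p \<in> B p \<and> emeasure (dens X) (B p) < \<infinity>"
    by metis
  obtain F where F: "F \<subseteq> K" "finite F" "K \<subseteq> (\<Union>p\<in>F. B p)"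
    using compactE_image[OF K(1), of K B] B by blast
  have "emeasure (dens X) K \<le> emeasure (dens X) (\<Union>p\<in>F. B p)"
    using F B by (intro emeasure_mono) (auto simp: sets_dens intro!: borel_open)
  also have "\<dots> \<le> (\<Sum>p\<in>F. emeasure (dens X) (B p))"
    using F B by (intro emeasure_subadditive_finite) (auto simp: sets_dens)
  also have "\<dots> < \<infinity>" using F B by auto
  finally have fin: "emeasure (dens X) K < \<infinity>" .
  have "bounded (bdf X ` K)"
    using K continuous_on_bdf
    by (intro compact_imp_bounded compact_continuous_image) (auto intro: continuous_on_subset)
  then obtain c where c: "\<And>p. p \<in> K \<Longrightarrow> \<bar>bdf X p\<bar> \<le> c" unfolding bounded_iff by auto
  have Kb: "K \<in> sets borel" by (intro borel_closed compact_imp_closed K(1))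
  have "emeasure (wmeas X m) K = (\<integral>\<^sup>+p. ennreal (bdf X p ^ m) * indicator K p \<partial>dens X)"
    unfolding wmeas_def using Kb by (intro emeasure_density) (auto simp: sets_dens)
  also have "\<dots> \<le> (\<integral>\<^sup>+p. ennreal (c ^ m) * indicator K p \<partial>dens X)"
  proof (intro nn_integral_mono)
    fix p
    have "bdf X p ^ m \<le> c ^ m" if "p \<in> K"
      using c[OF that] bdf_nonneg[of p] by (intro power_mono) auto
    then show "ennreal (bdf X p ^ m) * indicator K p \<le> ennreal (c ^ m) * indicator K p"
      by (auto split: split_indicator intro: ennreal_leI)
  qed
  also have "\<dots> = ennreal (c ^ m) * emeasure (dens X) K"
    using Kb by (subst nn_integral_cmult_indicator) (auto simp: sets_dens)
  also have "\<dots> < \<infinity>" using fin by (simp add: ennreal_mult_less_top)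
  finally show ?thesis .
qed

section \<open>The space of square integrable sections\<close>

lemma L2_iff: "u \<in> L2 X m \<longleftrightarrow> meas_sec X u \<and> integrable (wmeas X m) (\<lambda>p. herm X p (u p) (u p))"
  unfolding L2_def meas_sec_def by auto

lemma integrable_herm:
  assumes u: "u \<in> L2 X m" and v: "v \<in> L2 X m"
  shows "integrable (wmeas X m) (\<lambda>p. herm X p (u p) (v p))"
proof (rule Bochner_Integration.integrable_bound)
  show "integrable (wmeas X m) (\<lambda>p. Re (herm X p (u p) (u p)) + Re (herm X p (v p) (v p)))"
    using u v by (intro Bochner_Integration.integrable_add integrable_Re) (auto simp: L2_iff)
  show "(\<lambda>p. herm X p (u p) (v p)) \<in> borel_measurable (wmeas X m)"
    using borel_measurable_herm[of u v] u v
    by (simp add: L2_iff measurable_cong_sets[OF sets_wmeas refl])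
  show "AE p in wmeas X m. norm (herm X p (u p) (v p))
      \<le> norm (Re (herm X p (u p) (u p)) + Re (herm X p (v p) (v p)))"
    using norm_herm_le by (intro AE_I2) (metis abs_of_nonneg add_nonneg_nonneg herm_nonneg real_norm_def)
qed

lemma L2_add:
  assumes u: "u \<in> L2 X m" and v: "v \<in> L2 X m"
  shows "u + v \<in> L2 X m"
proof -
  have "integrable (wmeas X m) (\<lambda>p. herm X p (u p) (u p) + herm X p (u p) (v p) +
      (herm X p (v p) (u p) + herm X p (v p) (v p)))"
    using assms by (intro Bochner_Integration.integrable_add integrable_herm)
  then show ?thesis
    using assms by (simp add: L2_iff meas_sec_add herm_add_left herm_add_right algebra_simps)
qed

lemma L2_scale:
  assumes u: "u \<in> L2 X m"
  shows "scale_sec c u \<in> L2 X m"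
proof -
  have "integrable (wmeas X m) (\<lambda>p. c * (cnj c * herm X p (u p) (u p)))"
    using assms by (intro integrable_mult_right) (auto simp: L2_iff)
  then show ?thesis
    using assms
    by (simp add: L2_iff meas_sec_scale_sec) (simp add: scale_sec_def herm_scale_left herm_scale_right)
qed

lemma L2_zero: "0 \<in> L2 X m"
  unfolding L2_iff meas_sec_def by auto

lemma L2_subspace: "sec.subspace (L2 X m)"
  by (intro sec.subspaceI L2_zero L2_add L2_scale)

lemma ip_add_left:
  assumes "u \<in> L2 X m" "v \<in> L2 X m" "w \<in> L2 X m"
  shows "ip X m (u + v) w = ip X m u w + ip X m v w"
  using assms by (simp add: ip_def herm_add_left integrable_herm)

lemma ip_scale_left: "ip X m (scale_sec c u) w = c * ip X m u w"
  by (simp add: ip_def scale_sec_def herm_scale_left)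

lemma ip_zero_left: "ip X m 0 w = 0"
  by (simp add: ip_def)

lemma Re_ip_self:
  assumes "u \<in> L2 X m"
  shows "Re (ip X m u u) = (LINT p|wmeas X m. Re (herm X p (u p) (u p)))"
  using assms integrable_herm[of u u] unfolding ip_def by (simp add: integral_Re)

lemma Re_ip_self_nonneg: "u \<in> L2 X m \<Longrightarrow> 0 \<le> Re (ip X m u u)"
  by (simp add: Re_ip_self herm_nonneg)

text \<open>A nonnegative integrand with integral 0 vanishes almost everywhere, and the fibre metric
  is definite.\<close>

lemma Re_ip_self_eq_0_imp_Null:
  assumes u: "u \<in> L2 X m" and "Re (ip X m u u) = 0"
  shows "u \<in> Null X m"
proof -
  have "AE p in wmeas X m. Re (herm X p (u p) (u p)) = 0"
    using assms integrable_Re[OF integrable_herm[OF u u]] herm_nonneg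
    by (subst integral_nonneg_eq_0_iff_AE[symmetric]) (auto simp: Re_ip_self)
  then have "AE p in wmeas X m. u p = 0"
    by eventually_elim (use herm_pos in \<open>metis less_irrefl\<close>)
  then show ?thesis using u unfolding Null_def by simp
qed

text \<open>A substitute for the triangle inequality, integrated from \<open>herm_add_le\<close>;
  its constants are harmless for norms that tend to 0.\<close>

lemma L2norm_add_le:
  assumes u: "u \<in> L2 X m" and v: "v \<in> L2 X m"
  shows "(L2norm X m (u + v))\<^sup>2 \<le> 2 * (L2norm X m u)\<^sup>2 + 2 * (L2norm X m v)\<^sup>2"
proof -
  note [simp] = integrable_Re[OF integrable_herm]
  have "Re (ip X m (u + v) (u + v)) \<le>
      (LINT p|wmeas X m. 2 * Re (herm X p (u p) (u p)) + 2 * Re (herm X p (v p) (v p)))"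
    unfolding Re_ip_self[OF L2_add[OF u v]]
  proof (rule integral_mono)
    show "Re (herm X p ((u + v) p) ((u + v) p)) \<le>
        2 * Re (herm X p (u p) (u p)) + 2 * Re (herm X p (v p) (v p))" for p
      using herm_add_le by simp
    show "integrable (wmeas X m) (\<lambda>p. Re (herm X p ((u + v) p) ((u + v) p)))"
      using L2_add[OF u v] by (intro integrable_Re integrable_herm)
  qed (use assms in simp)
  also have "\<dots> = 2 * Re (ip X m u u) + 2 * Re (ip X m v v)"
    using assms by (simp add: Re_ip_self)
  finally show ?thesis
    using assms L2_add[OF u v] by (simp add: L2norm_def Re_ip_self_nonneg)
qed

lemma L2norm_scale: "L2norm X m (scale_sec c u) = norm c * L2norm X m u"
proof -
  have "ip X m (scale_sec c u) (scale_sec c u) = c * cnj c * ip X m u u"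
    by (simp add: ip_def scale_sec_def herm_scale_left herm_scale_right mult.assoc)
  also have "c * cnj c = complex_of_real ((norm c)\<^sup>2)" by (rule complex_norm_square[symmetric])
  finally show ?thesis unfolding L2norm_def by (simp add: real_sqrt_mult)
qed

lemma L2norm_tendsto_0_add:
  assumes L: "\<And>k. u k \<in> L2 X m" "\<And>k. v k \<in> L2 X m"
    and lim: "(\<lambda>k. L2norm X m (u k)) \<longlonglongrightarrow> 0" "(\<lambda>k. L2norm X m (v k)) \<longlonglongrightarrow> 0"
  shows "(\<lambda>k. L2norm X m (u k + v k)) \<longlonglongrightarrow> 0"
proof -
  have "(\<lambda>k. 2 * (L2norm X m (u k))\<^sup>2 + 2 * (L2norm X m (v k))\<^sup>2) \<longlonglongrightarrow> 2 * 0\<^sup>2 + 2 * 0\<^sup>2"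
    by (intro tendsto_intros lim)
  then have "(\<lambda>k. 2 * (L2norm X m (u k))\<^sup>2 + 2 * (L2norm X m (v k))\<^sup>2) \<longlonglongrightarrow> 0" by simp
  then have "(\<lambda>k. (L2norm X m (u k + v k))\<^sup>2) \<longlonglongrightarrow> 0"
    by (rule tendsto_sandwich[rotated 2, OF tendsto_const])
      (auto intro!: always_eventually L2norm_add_le L)
  from tendsto_real_sqrt[OF this] show ?thesis
    using Re_ip_self_nonneg[OF L2_add[OF L]] by (simp add: L2norm_def)
qed

lemma L2norm_tendsto_0_scale:
  assumes "(\<lambda>k. L2norm X m (u k)) \<longlonglongrightarrow> 0"
  shows "(\<lambda>k. L2norm X m (scale_sec c (u k))) \<longlonglongrightarrow> 0"
  using tendsto_mult_right_zero[OF assms] by (simp add: L2norm_scale)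

section \<open>Test sections\<close>

lemma test_sections_zero: "0 \<in> test_sections X"
proof -
  have "\<exists>K. compact K \<and> K \<subseteq> interior_part X" by (intro exI[of _ "{}"]) auto
  then show ?thesis
    unfolding test_sections_def msmooth_on_def by (auto simp: o_def smooth_on_const)
qed

lemma test_sections_add:
  assumes "s \<in> test_sections X" "t \<in> test_sections X"
  shows "s + t \<in> test_sections X"
proof -
  obtain K K' where K: "compact K" "K \<subseteq> interior_part X" "\<forall>p. p \<notin> K \<longrightarrow> s p = 0"
    "compact K'" "K' \<subseteq> interior_part X" "\<forall>p. p \<notin> K' \<longrightarrow> t p = 0"
    using assms unfolding test_sections_def by blast
  have "msmooth_on X V (\<lambda>p. \<tau> p *v (s + t) p)" if "(V, \<tau>) \<in> trivs X" for V \<tau>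
    using assms that msmooth_on_add[of X V "\<lambda>p. \<tau> p *v s p" "\<lambda>p. \<tau> p *v t p"]
    unfolding test_sections_def by (auto simp: matrix_vector_right_distrib)
  moreover have "\<exists>K. compact K \<and> K \<subseteq> interior_part X \<and> (\<forall>p. p \<notin> K \<longrightarrow> (s + t) p = 0)"
    using K by (intro exI[of _ "K \<union> K'"]) auto
  ultimately show ?thesis unfolding test_sections_def by blast
qed

lemma test_sections_scale:
  assumes "s \<in> test_sections X"
  shows "scale_sec c s \<in> test_sections X"
proof -
  obtain K where K: "compact K" "K \<subseteq> interior_part X" "\<forall>p. p \<notin> K \<longrightarrow> s p = 0"
    using assms unfolding test_sections_def by blast
  have "msmooth_on X V (\<lambda>p. \<tau> p *v scale_sec c s p)" if "(V, \<tau>) \<in> trivs X" for V \<tau>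
    using assms that msmooth_on_bounded_linear[OF bounded_linear_smult_vec, of X V "\<lambda>p. \<tau> p *v s p" c]
    unfolding test_sections_def by (auto simp: scale_sec_def vector_scalar_commute)
  moreover have "\<exists>K. compact K \<and> K \<subseteq> interior_part X \<and> (\<forall>p. p \<notin> K \<longrightarrow> scale_sec c s p = 0)"
    using K by (intro exI[of _ K]) (auto simp: scale_sec_def)
  ultimately show ?thesis unfolding test_sections_def by blast
qed

text \<open>The factor \<open>f\<close> is there for the weight \<open>inverse (bdf X p ^ m)\<close>
  in front of a cone operator; \<open>f = 1\<close> covers test sections themselves. Continuity in
  the interior suffices since the support of \<open>s\<close> is a compact subset of it, on which
  the squared length is bounded.\<close>

lemma test_section_times_L2:
  fixes f :: "'p \<Rightarrow> real"
  assumes s: "s \<in> test_sections X"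
    and f: "f \<in> borel_measurable borel" "continuous_on (interior_part X) f"
  shows "(\<lambda>p. complex_of_real (f p) *s s p) \<in> L2 X m"
proof -
  obtain K where K: "compact K" "K \<subseteq> interior_part X" "\<And>p. p \<notin> K \<Longrightarrow> s p = 0"
    using s unfolding test_sections_def by blast
  have cont: "continuous_on V (\<lambda>p. \<tau> p *v s p)" if "(V, \<tau>) \<in> trivs X" for V \<tau>
    using s that trivs_open[OF that] unfolding test_sections_def
    by (intro msmooth_on_imp_continuous_on[OF smooth]) auto
  have meas: "meas_sec X (\<lambda>p. complex_of_real (f p) *s s p)"
    unfolding meas_sec_def
  proof safe
    fix V \<tau> assume t: "(V, \<tau>) \<in> trivs X"
    have "(\<lambda>p. f p *\<^sub>R (\<tau> p *v s p)) \<in> borel_measurable (restrict_space borel V)"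
      using f(1) borel_measurable_continuous_on_restrict[OF cont[OF t]]
      by (intro borel_measurable_scaleR measurable_restrict_space1[OF f(1)])
    moreover have "\<tau> p *v (complex_of_real (f p) *s s p) = f p *\<^sub>R (\<tau> p *v s p)" for p
      unfolding vector_scalar_commute
      by (simp add: vec_eq_iff scaleR_conv_of_real[where 'a = complex])
    ultimately show "(\<lambda>p. \<tau> p *v (complex_of_real (f p) *s s p)) \<in> borel_measurable (restrict_space borel V)"
      by simp
  qed
  have "continuous_on V (\<lambda>p. herm X p (s p) (s p))" if t: "(V, \<tau>) \<in> trivs X" for V \<tau>
  proof -
    have "continuous_on V (\<lambda>p. \<Sum>i\<in>UNIV. \<Sum>j\<in>UNIV. (\<tau> p *v s p) $ i * cnj ((\<tau> p *v s p) $ j) *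
        herm X p (matrix_inv (\<tau> p) *v axis i 1) (matrix_inv (\<tau> p) *v axis j 1))"
      by (intro continuous_intros continuous_on_herm_frame[OF t] cont[OF t])
    then show ?thesis
      by (rule continuous_on_cong[THEN iffD1, OF refl, rotated]) (simp add: herm_local_frame[OF t])
  qed
  \<comment> \<open>The length of \<open>s\<close> does not depend on a trivialisation, so
    continuity over each domain gives continuity over their union, the whole manifold.\<close>
  then have "continuous_on (\<Union>t\<in>trivs X. fst t) (\<lambda>p. herm X p (s p) (s p))"
    using trivs_open by (intro continuous_on_open_UN) auto
  then have "continuous_on K (\<lambda>p. herm X p (s p) (s p))"
    using trivs_cover by (auto intro: continuous_on_subset)
  then have "continuous_on K (\<lambda>p. complex_of_real ((f p)\<^sup>2) * herm X p (s p) (s p))"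
    using f K by (intro continuous_intros) (auto intro: continuous_on_subset)
  then have "bounded ((\<lambda>p. complex_of_real ((f p)\<^sup>2) * herm X p (s p) (s p)) ` K)"
    using K by (intro compact_imp_bounded compact_continuous_image)
  then obtain c where c: "\<And>p. p \<in> K \<Longrightarrow> norm (complex_of_real ((f p)\<^sup>2) * herm X p (s p) (s p)) \<le> c"
    unfolding bounded_iff by auto
  have herm_eq: "herm X p (complex_of_real (f p) *s s p) (complex_of_real (f p) *s s p) =
      complex_of_real ((f p)\<^sup>2) * herm X p (s p) (s p)" for p
    by (simp add: herm_scale_left herm_scale_right power2_eq_square)
  have Kb: "K \<in> sets borel" by (intro borel_closed compact_imp_closed K(1))
  have "integrable (wmeas X m)
      (\<lambda>p. herm X p (complex_of_real (f p) *s s p) (complex_of_real (f p) *s s p))"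
  proof (rule Bochner_Integration.integrable_bound)
    \<comment> \<open>The majorant is a constant on the support of \<open>s\<close>, which has
      finite weighted measure.\<close>
    show "integrable (wmeas X m) (\<lambda>p. c * indicator K p)"
      using wmeas_compact_finite[OF K(1,2)] Kb
      by (intro integrable_mult_right integrable_real_indicator) (auto simp: sets_wmeas)
    show "(\<lambda>p. herm X p (complex_of_real (f p) *s s p) (complex_of_real (f p) *s s p))
        \<in> borel_measurable (wmeas X m)"
      using borel_measurable_herm[OF meas meas] by (simp add: measurable_cong_sets[OF sets_wmeas refl])
    show "AE p in wmeas X m. norm (herm X p (complex_of_real (f p) *s s p)
        (complex_of_real (f p) *s s p)) \<le> norm (c * indicator K p)"
    proof (intro AE_I2)
      fix p
      show "norm (herm X p (complex_of_real (f p) *s s p) (complex_of_real (f p) *s s p))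
          \<le> norm (c * indicator K p)"
        using c[of p] K(3)[of p] unfolding herm_eq by (cases "p \<in> K") auto
    qed
  qed
  with meas show ?thesis by (simp add: L2_iff)
qed

lemma test_sections_L2: "s \<in> test_sections X \<Longrightarrow> s \<in> L2 X m"
  using test_section_times_L2[of s "\<lambda>_. 1"] by simp

end

section \<open>Closed extensions\<close>

locale cone_operator = cone X m
  for X :: "('p::t2_space, 'n::finite, 'r::finite) cone_data" and m +
  fixes A :: "('p, 'r) sec \<Rightarrow> ('p, 'r) sec"
  assumes cone_Diff: "A \<in> cone_Diff X m"
begin

lemma cone_Diff_factor:
  obtains P where "\<And>s. s \<in> test_sections X \<Longrightarrow> P s \<in> test_sections X"
    "\<And>s t. s \<in> test_sections X \<Longrightarrow> t \<in> test_sections X \<Longrightarrow> P (s + t) = P s + P t"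
    "\<And>c s. s \<in> test_sections X \<Longrightarrow> P (\<lambda>p. c *s s p) = (\<lambda>p. c *s P s p)"
    "\<And>s. s \<in> test_sections X \<Longrightarrow> A s = (\<lambda>p. complex_of_real (inverse (bdf X p ^ m)) *s P s p)"
proof -
  obtain P where P: "P \<in> Diff_b X m" "\<And>s. s \<in> test_sections X \<Longrightarrow>
      A s = (\<lambda>p. complex_of_real (inverse (bdf X p ^ m)) *s P s p)"
    using cone_Diff unfolding cone_Diff_def by blast
  show thesis by (rule that[of P]) (use P in \<open>simp_all add: Diff_b_def\<close>)
qed

text \<open>\<open>A s\<close> is a power of \<open>bdf\<close> times the test section
  \<open>P s\<close>, whose support stays away from the boundary, where that weight may be
  singular.\<close>

lemma A_L2:
  assumes "s \<in> test_sections X"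
  shows "A s \<in> L2 X m"
proof (rule cone_Diff_factor)
  fix P assume P: "\<And>s. s \<in> test_sections X \<Longrightarrow> P s \<in> test_sections X"
    "\<And>s. s \<in> test_sections X \<Longrightarrow> A s = (\<lambda>p. complex_of_real (inverse (bdf X p ^ m)) *s P s p)"
  have "continuous_on (interior_part X) (\<lambda>p. inverse (bdf X p ^ m))"
    using continuous_on_subset[OF continuous_on_bdf]
    by (intro continuous_intros) (auto simp: bdf_eq_0_iff)
  then show ?thesis
    unfolding P(2)[OF assms] using P(1)[OF assms] by (intro test_section_times_L2) measurable
qed

lemma A_add:
  assumes "s \<in> test_sections X" and "t \<in> test_sections X"
  shows "A (s + t) = A s + A t"
proof (rule cone_Diff_factor)
  fix P assume "\<And>s t. s \<in> test_sections X \<Longrightarrow> t \<in> test_sections X \<Longrightarrow> P (s + t) = P s + P t"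
    "\<And>s. s \<in> test_sections X \<Longrightarrow> A s = (\<lambda>p. complex_of_real (inverse (bdf X p ^ m)) *s P s p)"
  then show ?thesis
    using assms test_sections_add[OF assms] by (simp add: fun_eq_iff vector_add_ldistrib)
qed

lemma A_scale:
  assumes "s \<in> test_sections X"
  shows "A (scale_sec c s) = scale_sec c (A s)"
proof (rule cone_Diff_factor)
  fix P assume "\<And>c s. s \<in> test_sections X \<Longrightarrow> P (\<lambda>p. c *s s p) = (\<lambda>p. c *s P s p)"
    "\<And>s. s \<in> test_sections X \<Longrightarrow> A s = (\<lambda>p. complex_of_real (inverse (bdf X p ^ m)) *s P s p)"
  then show ?thesis
    using assms test_sections_scale[OF assms, of c]
    by (simp add: scale_sec_def vector_smult_assoc mult.commute)
qed

text \<open>Approximating sequences are added and scaled term by term: \<open>A\<close> is linear on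
  test sections, and convergence to 0 in norm is preserved.\<close>

lemma D_min_subspace: "sec.subspace (D_min X m A)"
proof (rule sec.subspaceI)
  have "A 0 = 0" using A_scale[OF test_sections_zero, of 0] by simp
  then show "0 \<in> D_min X m A"
    unfolding D_min_def using L2_zero test_sections_zero
    by (intro CollectI conjI bexI[of _ 0] exI[of _ "\<lambda>_. 0"]) (auto simp: L2norm_def ip_zero_left)
next
  fix u u' assume "u \<in> D_min X m A" "u' \<in> D_min X m A"
  then obtain v v' and s s' :: "nat \<Rightarrow> ('p, 'r) sec"
    where u: "u \<in> L2 X m" "v \<in> L2 X m" "\<And>k. s k \<in> test_sections X"
      "(\<lambda>k. L2norm X m (s k - u)) \<longlonglongrightarrow> 0" "(\<lambda>k. L2norm X m (A (s k) - v)) \<longlonglongrightarrow> 0"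
      and u': "u' \<in> L2 X m" "v' \<in> L2 X m" "\<And>k. s' k \<in> test_sections X"
      "(\<lambda>k. L2norm X m (s' k - u')) \<longlonglongrightarrow> 0" "(\<lambda>k. L2norm X m (A (s' k) - v')) \<longlonglongrightarrow> 0"
    unfolding D_min_def by blast
  note diff = sec.subspace_diff[OF L2_subspace]
  have "(\<lambda>k. L2norm X m ((s k - u) + (s' k - u'))) \<longlonglongrightarrow> 0"
    using u u' by (intro L2norm_tendsto_0_add) (auto intro!: diff intro: test_sections_L2)
  moreover have "(\<lambda>k. L2norm X m ((A (s k) - v) + (A (s' k) - v'))) \<longlonglongrightarrow> 0"
    using u u' by (intro L2norm_tendsto_0_add) (auto intro!: diff intro: A_L2)
  ultimately show "u + u' \<in> D_min X m A"
    unfolding D_min_def using u u' L2_add test_sections_add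
    by (intro CollectI conjI bexI[of _ "v + v'"] exI[of _ "\<lambda>k. s k + s' k"])
      (auto simp: A_add algebra_simps)
next
  fix c u assume "u \<in> D_min X m A"
  then obtain v and s :: "nat \<Rightarrow> ('p, 'r) sec"
    where u: "u \<in> L2 X m" "v \<in> L2 X m" "\<And>k. s k \<in> test_sections X"
      "(\<lambda>k. L2norm X m (s k - u)) \<longlonglongrightarrow> 0" "(\<lambda>k. L2norm X m (A (s k) - v)) \<longlonglongrightarrow> 0"
    unfolding D_min_def by blast
  then show "scale_sec c u \<in> D_min X m A"
    unfolding D_min_def
    using L2_scale test_sections_scale L2norm_tendsto_0_scale[of "\<lambda>k. s k - u" c]
      L2norm_tendsto_0_scale[of "\<lambda>k. A (s k) - v" c]
    by (intro CollectI conjI bexI[of _ "scale_sec c v"] exI[of _ "\<lambda>k. scale_sec c (s k)"])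
      (auto simp: A_scale sec.scale_right_diff_distrib)
qed

section \<open>Linearity of the maximal graph\<close>

lemma graph_max_L2: "(u, v) \<in> graph_max X m A \<Longrightarrow> u \<in> L2 X m \<and> v \<in> L2 X m"
  unfolding graph_max_def by auto

lemma graph_max_zero: "(0, 0) \<in> graph_max X m A"
  unfolding graph_max_def by (auto simp: L2_zero ip_zero_left)

lemma graph_max_add:
  assumes "(u, v) \<in> graph_max X m A" and "(u', v') \<in> graph_max X m A"
  shows "(u + u', v + v') \<in> graph_max X m A"
proof -
  have "ip X m (u + u') \<psi> = ip X m (v + v') \<phi>" if "formal_adjoint X m A \<phi> \<psi>" for \<phi> \<psi>
  proof -
    \<comment> \<open>Additivity of \<open>ip\<close> rests on integrability of the products, so the
      two test sections are first placed in \<open>L2\<close>.\<close>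
    have "\<phi> \<in> L2 X m" "\<psi> \<in> L2 X m"
      using that test_sections_L2 unfolding formal_adjoint_def by auto
    then show ?thesis using assms that unfolding graph_max_def by (auto simp: ip_add_left)
  qed
  then show ?thesis using assms unfolding graph_max_def by (auto simp: L2_add)
qed

lemma graph_max_scale:
  "(u, v) \<in> graph_max X m A \<Longrightarrow> (scale_sec c u, scale_sec c v) \<in> graph_max X m A"
  unfolding graph_max_def by (auto simp: L2_scale ip_scale_left)

lemma graph_max_diff:
  assumes "(u, v) \<in> graph_max X m A" and "(u', v') \<in> graph_max X m A"
  shows "(u - u', v - v') \<in> graph_max X m A"
proof -
  have "scale_sec (- 1) w = - w" for w :: "('p, 'r) sec" by simp
  then show ?thesis
    using graph_max_add[OF assms(1) graph_max_scale[OF assms(2), of "- 1"]] by simp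
qed

lemma D_max_subspace: "sec.subspace (D_max X m A)"
  unfolding D_max_def
  by (rule sec.subspaceI)
    (use graph_max_zero in blast, (blast intro: graph_max_add graph_max_scale)+)

section \<open>The Grassmannian\<close>

text \<open>The graph inner product of \<open>u\<close> with itself is a sum of two nonnegative
  terms, one of which is the squared norm of \<open>u\<close>. This is what makes the Grassmannian
  chart trivial at the two extreme domains.\<close>

lemma graph_orth_self_imp_Null:
  assumes "u \<in> D_max X m A" and "graph_orth X m A u u"
  shows "u \<in> Null X m"
proof -
  obtain v where v: "(u, v) \<in> graph_max X m A" using assms(1) unfolding D_max_def by blast
  then have "ip X m v v + ip X m u u = 0" using assms(2) unfolding graph_orth_def by blast
  from arg_cong[where f = Re, OF this] have "Re (ip X m v v) + Re (ip X m u u) = 0" by simp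
  then have "Re (ip X m u u) = 0"
    using graph_max_L2[OF v] Re_ip_self_nonneg[of u] Re_ip_self_nonneg[of v] by auto
  then show ?thesis using graph_max_L2[OF v] by (intro Re_ip_self_eq_0_imp_Null) auto
qed

text \<open>If \<open>U\<close> consists of null sections, every map in \<open>Homs N U W\<close> is
  null-valued because it preserves \<open>N\<close>; if \<open>W\<close> does, this is immediate.
  Either way the model space is zero modulo null-valued maps.\<close>

lemma local_dim_eq_0:
  assumes "\<D> \<inter> E_max X m A \<subseteq> Null X m \<or>
    {u\<in>E_max X m A. \<forall>w\<in>\<D> \<inter> E_max X m A. graph_orth X m A u w} \<subseteq> Null X m"
  shows "local_dim X m A \<D> = 0"
proof -
  have "Homs N U W \<subseteq> Homs N U N" if "U \<subseteq> N \<or> W \<subseteq> N" for N U W :: "('p, 'r) sec set"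
    using that unfolding Homs_def by blast
  then show ?thesis
    using assms unfolding local_dim_def Let_def by (intro qdim_eq_0) auto
qed

text \<open>Elements of \<open>D_min\<close> in its own orthogonal complement are orthogonal to
  themselves, so here \<open>U\<close> is null.\<close>

lemma local_dim_D_min: "local_dim X m A (D_min X m A) = 0"
  using graph_orth_self_imp_Null by (intro local_dim_eq_0 disjI1) (auto simp: E_max_def)

text \<open>Here \<open>U\<close> is all of \<open>E_max\<close>, so elements of its complement
  within \<open>E_max\<close> are orthogonal to themselves and \<open>W\<close> is null.\<close>

lemma local_dim_D_max: "local_dim X m A (D_max X m A) = 0"
  using graph_orth_self_imp_Null by (intro local_dim_eq_0 disjI2) (auto simp: E_max_def)

lemma dim_domains_singleton:
  "index_zero_domains X m A = {\<D>} \<Longrightarrow> dim_domains X m A = local_dim X m A \<D>"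
  unfolding dim_domains_def by simp

lemma dim_domains_pos_imp:
  assumes "0 < dim_domains X m A"
  obtains \<D> d where "\<D> \<in> index_zero_domains X m A" "\<D> \<noteq> D_max X m A"
    "int (Suc d) = - ind X m (A_on X m A (D_min X m A))"
proof -
  have ne: "index_zero_domains X m A \<noteq> {}" using assms unfolding dim_domains_def by auto
  have neq: "index_zero_domains X m A \<noteq> {\<D>}" if "local_dim X m A \<D> = 0" for \<D>
    using dim_domains_singleton[of \<D>] assms that by auto
  from ne neq[OF local_dim_D_max] obtain \<D> where \<D>: "\<D> \<in> index_zero_domains X m A" "\<D> \<noteq> D_max X m A"
    by blast
  \<comment> \<open>A possibly different member is used for the dimension. The index prescribes the
    same dimension over \<open>D_min\<close> for all members, so its positivity at
    \<open>\<D>'\<close> is also positivity at \<open>\<D>\<close>.\<close>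
  from ne neq[OF local_dim_D_min] obtain \<D>' where \<D>': "\<D>' \<in> index_zero_domains X m A" "\<D>' \<noteq> D_min X m A"
    by blast
  then obtain d where d: "has_qdim scale_sec \<D>' (D_min X m A) d"
    "int d = - ind X m (A_on X m A (D_min X m A))" "D_min X m A \<subseteq> \<D>'"
    unfolding index_zero_domains_def by blast
  have "d \<noteq> 0"
  proof
    assume "d = 0"
    with d(1) have "\<D>' \<subseteq> D_min X m A" unfolding has_qdim_def by auto
    with d(3) \<D>'(2) show False by blast
  qed
  then show thesis using that \<D> d(2) by (metis not0_implies_Suc)
qed

section \<open>Eigenvectors and the spectrum\<close>

lemma eigenvalue_imp_spec:
  assumes "(x, scale_sec \<zeta> x) \<in> A_on X m A \<D>" and "x \<notin> Null X m"
  shows "\<zeta> \<in> spec X m (A_on X m A \<D>)"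
  using assms unfolding spec_def by blast

lemma not_spec_imp_eigenvector:
  assumes \<zeta>: "\<zeta> \<notin> spec X m (A_on X m A \<D>)"
    and \<D>: "sec.subspace \<D>" "\<D> \<subseteq> D_max X m A" "\<D> \<noteq> D_max X m A"
  obtains x where "(x, scale_sec \<zeta> x) \<in> graph_max X m A" "x \<notin> \<D>" "x \<notin> Null X m"
proof -
  from \<zeta> have ker: "{u. (u, scale_sec \<zeta> u) \<in> A_on X m A \<D>} = Null X m"
    and ran: "{v - scale_sec \<zeta> u | u v. (u, v) \<in> A_on X m A \<D>} = L2 X m"
    unfolding spec_def by auto
  obtain u v where u: "(u, v) \<in> graph_max X m A" "u \<notin> \<D>"
    using \<D> unfolding D_max_def by blast
  have "v - scale_sec \<zeta> u \<in> L2 X m"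
    using graph_max_L2[OF u(1)] by (intro sec.subspace_diff[OF L2_subspace] L2_scale) auto
  \<comment> \<open>Surjectivity within \<open>\<D>\<close> produces \<open>w\<close> with the same
    image as \<open>u\<close> under the operator minus \<open>\<zeta>\<close>; hence
    \<open>u - w\<close> is an eigenvector of the maximal extension.\<close>
  then obtain w z where w: "(w, z) \<in> graph_max X m A" "w \<in> \<D>"
    and eq: "v - scale_sec \<zeta> u = z - scale_sec \<zeta> w"
    unfolding ran[symmetric] A_on_def by blast
  have "v - z = scale_sec \<zeta> (u - w)"
    using eq by (simp add: sec.scale_right_diff_distrib algebra_simps)
  then have "(u - w, scale_sec \<zeta> (u - w)) \<in> graph_max X m A"
    using graph_max_diff[OF u(1) w(1)] by simp
  moreover have "u - w \<notin> \<D>"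
    using sec.subspace_add[OF \<D>(1) _ w(2), of "u - w"] u(2) by auto
  \<comment> \<open>The kernel clause of the resolvent condition places all null sections in
    \<open>\<D>\<close>, so a vector outside \<open>\<D>\<close> is automatically not null.\<close>
  moreover have "Null X m \<subseteq> \<D>" using ker unfolding A_on_def by blast
  ultimately show thesis using that by blast
qed

end

section \<open>Exchange of domains along an eigenvector\<close>

theorem proposition5p7:
  fixes X :: "('p::t2_space, 'n::finite, 'r::finite) cone_data"
    and m :: nat
    and A :: "('p, 'r) sec \<Rightarrow> ('p, 'r) sec"
  assumes "cone_geometry X"
    and "A \<in> cone_Diff X m"
    and "c_elliptic X m A"
    and "ind X m (A_on X m A (D_min X m A)) \<le> 0"
    and "0 \<le> ind X m (A_on X m A (D_max X m A))"
    and "0 < dim_domains X m A"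
  shows "\<forall>\<zeta>::complex. \<exists>\<D>\<in>index_zero_domains X m A. \<zeta> \<in> spec X m (A_on X m A \<D>)"
proof
  fix \<zeta> :: complex
  interpret cone_operator X m A using assms(1,2) by unfold_locales
  obtain \<D> d where \<D>: "\<D> \<in> index_zero_domains X m A" "\<D> \<noteq> D_max X m A"
    and d: "int (Suc d) = - ind X m (A_on X m A (D_min X m A))"
    using dim_domains_pos_imp[OF assms(6)] .
  show "\<exists>\<D>\<in>index_zero_domains X m A. \<zeta> \<in> spec X m (A_on X m A \<D>)"
  proof (cases "\<zeta> \<in> spec X m (A_on X m A \<D>)")
    case True
    with \<D> show ?thesis by blast
  next
    case False
    from \<D> obtain d' where sub: "sec.subspace \<D>" "D_min X m A \<subseteq> \<D>" "\<D> \<subseteq> D_max X m A"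
      and d': "has_qdim scale_sec \<D> (D_min X m A) d'"
      "int d' = - ind X m (A_on X m A (D_min X m A))"
      unfolding index_zero_domains_def by blast
    \<comment> \<open>Both numbers equal minus the index at \<open>D_min\<close>; the successor form
      guarantees a basis vector to exchange.\<close>
    have "d' = Suc d" using d d'(2) by linarith
    with d'(1) have qdim: "has_qdim scale_sec \<D> (D_min X m A) (Suc d)" by simp
    obtain x where x: "(x, scale_sec \<zeta> x) \<in> graph_max X m A" "x \<notin> \<D>" "x \<notin> Null X m"
      using not_spec_imp_eigenvector[OF False sub(1,3) \<D>(2)] .
    obtain \<D>' where \<D>': "sec.subspace \<D>'" "D_min X m A \<subseteq> \<D>'" "x \<in> \<D>'"
      "\<D>' \<subseteq> sec.span (insert x \<D>)"
      "has_qdim scale_sec \<D>' (D_min X m A) (Suc d)"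
      using has_qdim_exchange[OF vector_space_scale_sec D_min_subspace sub(1,2) qdim x(2)] .
    have "x \<in> D_max X m A" using x(1) unfolding D_max_def by blast
    \<comment> \<open>The exchanged domain is confined to this span, and so remains a domain of the
      maximal extension.\<close>
    then have "sec.span (insert x \<D>) \<subseteq> D_max X m A"
      using sub(3) by (intro sec.span_minimal D_max_subspace) blast
    with \<D>'(4) have "\<D>' \<subseteq> D_max X m A" by blast
    then have "\<D>' \<in> index_zero_domains X m A"
      unfolding index_zero_domains_def using \<D>'(1,2,5) d by blast
    \<comment> \<open>The non-null eigenvector \<open>x\<close> now belongs to the domain, which
      violates the kernel clause of the resolvent condition.\<close>
    moreover have "\<zeta> \<in> spec X m (A_on X m A \<D>')"
      using x \<D>'(3) by (intro eigenvalue_imp_spec[of x]) (auto simp: A_on_def)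
    ultimately show ?thesis by blast
  qed
qed

end
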